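(* Let $\{X^k,H^k,D^k\}$ be the sequence generated by the LEAD iteration with iteration-dependent parameters $\eta_k,\gamma_k,\alpha_k$. Assume: (i) $W$ is a mixing matrix; (ii) the compression operator is unbiased and $C$-contracted with constant $C\ge0$; (iii) the stochastic gradients are unbiased with variances bounded by $\sigma_i^2$, and $\sigma^2=\frac1n\sum_{i=1}^n\sigma_i^2$; (iv) each $f_i$ is $L$-smooth and $\mu$-strongly convex with $L\ge\mu>0$. Let $\beta:=\lambda_{\max}(I-W)$ and define the constants $$\theta_1=\frac{1}{2\lambda_{\max}((I-W)^\dagger)},\quad \theta_2=\frac{C\beta}{2(1+C)},\quad\theta_3=\min\{\theta_1,\theta_2\},\quad\theta_4\in\Big(0,\frac{\mu}{C\beta}\Big),\quad \eta_*=\frac{2(\mu-C\beta\theta_4)}{\mu^2},$$ $$\theta_5=\min\Big\{\frac{2}{\mu+L},\ \eta_*,\ \frac{(3C+1)-\sqrt{(3C+1)^2-4C}}{C\beta\theta_4},\ \frac{2}{\beta\theta_4}\Big\}.$$ If $\eta_k=\frac{2\theta_5}{\theta_3\theta_4\theta_5k+2}$ and $\gamma_k=\theta_4\eta_k$, then by taking $\alpha_k=\frac{C\beta\gamma_k}{2(1+C)}$ we have, in total expectation, $$\frac1n\sum_{i=1}^n\mathbb E\|x_i^k-x^*\|^2\lesssim\mathcal O\Big(\frac1k\Big).$$ The complexity bound for arriving at the $\epsilon$-accurate solution is $\mathcal O(\frac1\epsilon)$.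
   Context: Problem: $n$ agents minimize $f(x)=\frac1n\sum_{i=1}^n f_i(x)$ over $x\in\mathbb R^d$, with minimizer $x^*$. For $X\in\mathbb R^{n\times d}$ with rows $x_1^\top,\dots,x_n^\top$, $\nabla F(X;\xi)\in\mathbb R^{n\times d}$ is the matrix with $i$-th row the stochastic gradient $\nabla f_i(x_i;\xi_i)^\top$. $(x_i^k)^\top$ denotes the $i$-th row of $X^k$. $\dagger$ denotes the pseudoinverse and $\lambda_{\max}$ the largest eigenvalue. Mixing matrix: $W=[w_{ij}]\in\mathbb R^{n\times n}$ is symmetric, doubly stochastic and primitive, with $w_{ij}=0$ when agents $i,j$ are not connected in a connected undirected graph; hence $-1<\lambda_n(W)\le\dots\le\lambda_2(W)<\lambda_1(W)=1$ and $W\mathbf 1=\mathbf 1$. Compression: a random operator $Q:\mathbb R^d\to\mathbb R^d$ is unbiased and $C$-contracted if $\mathbb E Q(x)=x$ and $\mathbb E\|x-Q(x)\|_2^2\le C\|x\|_2^2$ for all $x$. $\mathrm{Compress}(A)$ applies $Q$ to each row of $A$, with fresh randomness at each iteration, so these properties hold conditionally on everything generated before the compression step. Stochastic gradients: $\mathbb E_\xi\nabla f_i(x;\xi)=\nabla f_i(x)$ and $\mathbb E_\xi\|\nabla f_i(x;\xi)-\nabla f_i(x)\|_2^2\le\sigma_i^2$ for all $x$ and $i$; samples are fresh at each iteration, so these hold conditionally on the past. $L$-smooth and $\mu$-strongly convex: for all $x,y$, $f_i(y)+\langle\nabla f_i(y),x-y\rangle+\frac\mu2\|x-y\|^2\le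 f_i(x)\le f_i(y)+\langle\nabla f_i(y),x-y\rangle+\frac L2\|x-y\|^2$. LEAD with iteration-dependent parameters: given $X^0,H^1\in\mathbb R^{n\times d}$ and $D^1=(I-W)Z$ for any $Z\in\mathbb R^{n\times d}$, set $X^1=X^0-\eta_0\nabla F(X^0;\xi^0)$, and for $k=1,2,\dots$: $Y^k=X^k-\eta_k\nabla F(X^k;\xi^k)-\eta_k D^k$; $Q^k=\mathrm{Compress}(Y^k-H^k)$, $\hat Y^k=H^k+Q^k$; $H^{k+1}=(1-\alpha_k)H^k+\alpha_k\hat Y^k$; $D^{k+1}=D^k+\frac{\gamma_k}{2\eta_k}(I-W)\hat Y^k$; $X^{k+1}=X^k-\eta_k\nabla F(X^k;\xi^k)-\eta_k D^{k+1}$. *)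

theory Defs
  imports "HOL-Probability.Probability" "HOL-Library.Landau_Symbols"
begin

text \<open>The product \<open>*\<close> on \<^typ>\<open>real^'n^'n\<close> is componentwise, so
  matrix powers are iterated \<open>**\<close>.\<close>

definition matpow :: "real^'n^'n \<Rightarrow> nat \<Rightarrow> real^'n^'n" where
  "matpow A m = ((\<lambda>B. A ** B) ^^ m) (mat 1)"

definition doubly_stochastic :: "real^'n^'n \<Rightarrow> bool" where
  "doubly_stochastic W \<longleftrightarrow>
     (\<forall>i j. 0 \<le> W $ i $ j) \<and> (\<forall>i. (\<Sum>j\<in>UNIV. W $ i $ j) = 1) \<and> (\<forall>j. (\<Sum>i\<in>UNIV. W $ i $ j) = 1)"

definition primitive_matrix :: "real^'n^'n \<Rightarrow> bool" where
  "primitive_matrix W \<longleftrightarrow>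
     (\<forall>i j. 0 \<le> W $ i $ j) \<and> (\<exists>m\<ge>1. \<forall>i j. 0 < matpow W m $ i $ j)"

definition connected_graph :: "('n \<Rightarrow> 'n \<Rightarrow> bool) \<Rightarrow> bool" where
  "connected_graph E \<longleftrightarrow> symp E \<and> (\<forall>i j. E\<^sup>*\<^sup>* i j)"

definition mixing_matrix :: "('n \<Rightarrow> 'n \<Rightarrow> bool) \<Rightarrow> real^'n^'n \<Rightarrow> bool" where
  "mixing_matrix E W \<longleftrightarrow>
     transpose W = W \<and> doubly_stochastic W \<and> primitive_matrix W \<and>
     (\<forall>i j. i \<noteq> j \<and> \<not> E i j \<longrightarrow> W $ i $ j = 0)"

definition is_eigenvalue :: "real^'n^'n \<Rightarrow> real \<Rightarrow> bool" where
  "is_eigenvalue A l \<longleftrightarrow> (\<exists>v. v \<noteq> 0 \<and> A *v v = l *\<^sub>R v)"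

text \<open>Only meaningful for matrices with a real eigenvalue, in particular symmetric ones.\<close>

definition lambda_max :: "real^'n^'n \<Rightarrow> real" where
  "lambda_max A = (GREATEST l. is_eigenvalue A l)"

text \<open>The Moore--Penrose inverse, characterised by the four Penrose equations.\<close>

definition pseudoinverse :: "real^'n^'n \<Rightarrow> real^'n^'n" where
  "pseudoinverse A = (THE B. A ** B ** A = A \<and> B ** A ** B = B \<and>
     transpose (A ** B) = A ** B \<and> transpose (B ** A) = B ** A)"

definition smooth_strongly_convex ::
  "('v::real_inner \<Rightarrow> real) \<Rightarrow> ('v \<Rightarrow> 'v) \<Rightarrow> real \<Rightarrow> real \<Rightarrow> bool" where
  "smooth_strongly_convex f gradf L \<mu> \<longleftrightarrow>
     (\<forall>x. GDERIV f x :> gradf x) \<and>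
     (\<forall>x y. f y + gradf y \<bullet> (x - y) + \<mu> / 2 * (norm (x - y))\<^sup>2 \<le> f x \<and>
            f x \<le> f y + gradf y \<bullet> (x - y) + L / 2 * (norm (x - y))\<^sup>2)"

text \<open>\<open>R\<close> is the law of the random seed \<open>t\<close> used by the random operator \<open>q \<cdot> t\<close>. The
  integrability clauses are needed because \<open>integral\<^sup>L\<close> is \<open>0\<close> on non-integrable functions.\<close>

definition unbiased_contracted ::
  "real \<Rightarrow> 't measure \<Rightarrow> (real^'d \<Rightarrow> 't \<Rightarrow> real^'d) \<Rightarrow> bool" where
  "unbiased_contracted C R q \<longleftrightarrow>
     prob_space R \<and> case_prod q \<in> borel_measurable (borel \<Otimes>\<^sub>M R) \<and>
     (\<forall>x. integrable R (q x) \<and> (\<integral>t. q x t \<partial>R) = x \<and>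
          integrable R (\<lambda>t. (norm (x - q x t))\<^sup>2) \<and>
          (\<integral>t. (norm (x - q x t))\<^sup>2 \<partial>R) \<le> C * (norm x)\<^sup>2)"

text \<open>\<open>g x s\<close> is the stochastic gradient at \<open>x\<close> for the sample \<open>s\<close>, which has law \<open>S\<close>.\<close>

definition stochastic_gradient ::
  "real \<Rightarrow> 's measure \<Rightarrow> (real^'d \<Rightarrow> 's \<Rightarrow> real^'d) \<Rightarrow> (real^'d \<Rightarrow> real^'d) \<Rightarrow> bool" where
  "stochastic_gradient \<sigma> S g gradf \<longleftrightarrow>
     prob_space S \<and> case_prod g \<in> borel_measurable (borel \<Otimes>\<^sub>M S) \<and>
     (\<forall>x. integrable S (g x) \<and> (\<integral>s. g x s \<partial>S) = gradf x \<and>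
          integrable S (\<lambda>s. (norm (g x s - gradf x))\<^sup>2) \<and>
          (\<integral>s. (norm (g x s - gradf x))\<^sup>2 \<partial>S) \<le> \<sigma>\<^sup>2)"

text \<open>\<open>\<xi> k \<omega> i\<close> is the data sample and \<open>\<zeta> k \<omega> i\<close> the compression seed of agent \<open>i\<close> at
  iteration \<open>k\<close>. The last clause says that the whole family of the vectors \<open>\<xi> k\<close> and
  \<open>\<zeta> k\<close>, over all \<open>k\<close>, is mutually independent; the agents' samples (or seeds) within one
  iteration may be dependent.\<close>

definition fresh_randomness ::
  "'a measure \<Rightarrow> ('n::finite \<Rightarrow> 's measure) \<Rightarrow> 't measure \<Rightarrow>
   (nat \<Rightarrow> 'a \<Rightarrow> 'n \<Rightarrow> 's) \<Rightarrow> (nat \<Rightarrow> 'a \<Rightarrow> 'n \<Rightarrow> 't) \<Rightarrow> bool" where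
  "fresh_randomness M S R \<xi> \<zeta> \<longleftrightarrow>
     (\<forall>k i. (\<lambda>\<omega>. \<xi> k \<omega> i) \<in> measurable M (S i) \<and> distr M (S i) (\<lambda>\<omega>. \<xi> k \<omega> i) = S i) \<and>
     (\<forall>k i. (\<lambda>\<omega>. \<zeta> k \<omega> i) \<in> measurable M R \<and> distr M R (\<lambda>\<omega>. \<zeta> k \<omega> i) = R) \<and>
     prob_space.indep_sets M
       (case_sum (\<lambda>k. sets (vimage_algebra (space M) (\<xi> k) (PiM UNIV S)))
                 (\<lambda>k. sets (vimage_algebra (space M) (\<zeta> k) (PiM UNIV (\<lambda>_. R)))))
       (UNIV :: (nat + nat) set)"

definition stoch_grad_matrix ::
  "('n \<Rightarrow> real^'d \<Rightarrow> 's \<Rightarrow> real^'d) \<Rightarrow> real^'d^'n \<Rightarrow> ('n \<Rightarrow> 's) \<Rightarrow> real^'d^'n" where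
  "stoch_grad_matrix g X s = (\<chi> i. g i (X $ i) (s i))"

definition compress ::
  "(real^'d \<Rightarrow> 't \<Rightarrow> real^'d) \<Rightarrow> real^'d^'n \<Rightarrow> ('n \<Rightarrow> 't) \<Rightarrow> real^'d^'n" where
  "compress q A t = (\<chi> i. q (A $ i) (t i))"

text \<open>One sample path of LEAD, driven by the samples \<open>s\<close> and the compression seeds \<open>t\<close>.
  \<open>H\<close> and \<open>D\<close> are indexed from \<open>1\<close>; their values at \<open>0\<close> are irrelevant.\<close>

definition lead_path ::
  "real^'n^'n \<Rightarrow> ('n \<Rightarrow> real^'d \<Rightarrow> 's \<Rightarrow> real^'d) \<Rightarrow> (real^'d \<Rightarrow> 't \<Rightarrow> real^'d) \<Rightarrow>
   (nat \<Rightarrow> real) \<Rightarrow> (nat \<Rightarrow> real) \<Rightarrow> (nat \<Rightarrow> real) \<Rightarrow>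
   real^'d^'n \<Rightarrow> real^'d^'n \<Rightarrow> real^'d^'n \<Rightarrow> (nat \<Rightarrow> 'n \<Rightarrow> 's) \<Rightarrow> (nat \<Rightarrow> 'n \<Rightarrow> 't) \<Rightarrow>
   (nat \<Rightarrow> real^'d^'n) \<Rightarrow> (nat \<Rightarrow> real^'d^'n) \<Rightarrow> (nat \<Rightarrow> real^'d^'n) \<Rightarrow> bool" where
  "lead_path W g q \<eta> \<gamma> \<alpha> X0 H1 Z s t X H D \<longleftrightarrow>
     X 0 = X0 \<and> H 1 = H1 \<and> D 1 = (mat 1 - W) ** Z \<and>
     X 1 = X0 - \<eta> 0 *\<^sub>R stoch_grad_matrix g X0 (s 0) \<and>
     (\<forall>k\<ge>1.
        let G = stoch_grad_matrix g (X k) (s k);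
            Y = X k - \<eta> k *\<^sub>R G - \<eta> k *\<^sub>R D k;
            Q = compress q (Y - H k) (t k);
            Yhat = H k + Q
        in H (Suc k) = (1 - \<alpha> k) *\<^sub>R H k + \<alpha> k *\<^sub>R Yhat \<and>
           D (Suc k) = D k + (\<gamma> k / (2 * \<eta> k)) *\<^sub>R ((mat 1 - W) ** Yhat) \<and>
           X (Suc k) = X k - \<eta> k *\<^sub>R G - \<eta> k *\<^sub>R D (Suc k))"

end

theory Submission
  imports Defs
begin

text \<open>
  Write \<open>A = I - W\<close>, \<open>D\<^sup>* = - \<nabla>F(X\<^sup>*)\<close>, and let \<open>A\<^sup>\<dagger>\<close> be the pseudoinverse. The Lyapunov function
  \<open>E\<parallel>X - X\<^sup>*\<parallel>\<^sup>2 + (2 \<eta> / \<theta>\<^sub>4) E\<langle>D - D\<^sup>*, A\<^sup>\<dagger> (D - D\<^sup>*)\<rangle> + 2 (1 + C) E\<parallel>H - X\<^sup>*\<parallel>\<^sup>2\<close>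
  contracts, once \<open>\<eta>\<close> is small enough, by the factor \<open>1 - 3/4 \<theta>\<^sub>3 \<theta>\<^sub>4 \<eta>\<close> up to a noise term of order
  \<open>\<eta>\<^sup>2\<close>. Three quarters of the rate \<open>\<theta>\<^sub>3 \<theta>\<^sub>4\<close> suffice: asymptotically
  \<open>\<eta>\<^sub>k \<sim> 2 / (\<theta>\<^sub>3 \<theta>\<^sub>4 k)\<close>, so the factor is \<open>1 - (3/2) / k\<close>, and any constant above \<open>1\<close> in
  place of \<open>3/2\<close> yields the rate \<open>1 / k\<close>. Since \<open>\<eta>\<^sub>k \<rightarrow> 0\<close>, only finitely many iterations violate
  the smallness conditions, and on these finite second moments are enough.
\<close>

section \<open>Symmetric matrices and the pseudoinverse\<close>

text \<open>The weights of the Lyapunov function are dictated by cancellations. With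
  \<open>2 * \<eta>\<^sup>2 / \<gamma>\<close>, that is
  \<open>2 * \<eta> / \<theta>\<^sub>4\<close>, on the dual form, the cross terms of the primal and
  the dual update cancel, and \<open>- \<eta>\<^sup>2\<close> times the squared norm of the dual gap
  is left over; this is the source of the dual decrease. With \<open>2 * (1 + C)\<close> on the
  error of \<open>H\<close>, the update of \<open>H\<close> contributes a negative multiple of the
  squared norm of \<open>Y - H\<close>, which for small steps pays for the compression variance,
  itself bounded by a multiple of the same quantity. The price is a positive term in the error of
  \<open>Y\<close>. That error contains the dual gap, and splitting it off consumes a quarter of the
  dual decrease; hence the three quarters. The pseudoinverse can serve as a metric because the dual
  gap never leaves the range of \<open>I - W\<close>: the initial value and every update lie there,
  and so does the optimal dual value, as the gradients at the minimizer sum to zero.\<close>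

lemma psd_norm_le:
  fixes T :: "'v::real_inner \<Rightarrow> 'v"
  assumes lin: "linear T" and sym: "\<And>u v. T u \<bullet> v = u \<bullet> T v"
    and psd: "\<And>v. 0 \<le> v \<bullet> T v" and le: "\<And>v. v \<bullet> T v \<le> b * (norm v)\<^sup>2" and "0 < b"
  shows "(norm (T v))\<^sup>2 \<le> b * (v \<bullet> T v)"
proof -
  \<comment> \<open>The minimizer of \<open>- 2 * t + b * t\<^sup>2\<close>, which is the factor of
    \<open>(norm (T v))\<^sup>2\<close> in the bound below.\<close>
  define t where "t = 1 / b"
  have "0 \<le> (v - t *\<^sub>R T v) \<bullet> T (v - t *\<^sub>R T v)" by (rule psd)
  also have "\<dots> = v \<bullet> T v - 2 * t * (norm (T v))\<^sup>2 + t\<^sup>2 * (T v \<bullet> T (T v))"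
    using sym[of v "T v"]
    by (simp add: linear_diff[OF lin] linear_scale[OF lin] inner_diff_left inner_diff_right
        inner_commute algebra_simps flip: power2_norm_eq_inner power2_eq_square)
  also have "\<dots> \<le> v \<bullet> T v - 2 * t * (norm (T v))\<^sup>2 + t\<^sup>2 * (b * (norm (T v))\<^sup>2)"
    by (intro add_left_mono mult_left_mono le) auto
  also have "\<dots> = v \<bullet> T v - (norm (T v))\<^sup>2 / b"
    using \<open>0 < b\<close> by (simp add: t_def power2_eq_square field_simps)
  finally show ?thesis using \<open>0 < b\<close> by (simp add: field_simps)
qed

lemma symmetric_matrix_inner:
  fixes A :: "real^'n^'n"
  assumes "transpose A = A"
  shows "(A *v u) \<bullet> v = u \<bullet> (A *v v)"
  using dot_lmul_matrix[of u A v] assms by (metis matrix_transpose_mul transpose_matrix_vector)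

text \<open>The Rayleigh quotient attains its supremum on the unit sphere, at an eigenvector.\<close>

lemma
  fixes A :: "real^'n^'n"
  assumes sym: "transpose A = A"
  shows is_eigenvalue_lambda_max: "is_eigenvalue A (lambda_max A)"
    and inner_le_lambda_max: "v \<bullet> (A *v v) \<le> lambda_max A * (norm v)\<^sup>2"
proof -
  have cont: "continuous_on (sphere 0 1) (\<lambda>v. v \<bullet> (A *v v))"
    by (intro continuous_intros linear_continuous_on matrix_vector_mul_bounded_linear)
  have "axis undefined 1 \<in> sphere (0::real^'n) 1"
    by simp
  then have "sphere (0::real^'n) 1 \<noteq> {}" by blast
  then obtain v0 where v0: "norm v0 = 1" and max: "\<And>v. norm v = 1 \<Longrightarrow> v \<bullet> (A *v v) \<le> v0 \<bullet> (A *v v0)"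
    using continuous_attains_sup[OF compact_sphere _ cont] by (auto simp: sphere_def dist_norm simp del: Collect_empty_eq)
  define m where "m = v0 \<bullet> (A *v v0)"
  have ray: "v \<bullet> (A *v v) \<le> m * (norm v)\<^sup>2" for v
  proof (cases "v = 0")
    case False
    have "(v /\<^sub>R norm v) \<bullet> (A *v (v /\<^sub>R norm v)) \<le> m"
      unfolding m_def by (rule max) (use False in simp)
    then have "(v \<bullet> (A *v v)) / (norm v)\<^sup>2 \<le> m"
      by (simp add: matrix_vector_mult_scaleR power2_eq_square divide_inverse mult_ac)
    then show ?thesis using False by (simp add: divide_le_eq)
  qed simp
  \<comment> \<open>\<open>T\<close> is positive semidefinite and its form vanishes at
    \<open>v0\<close>, so \<open>psd_norm_le\<close> forces \<open>T v0 = 0\<close>. This replaces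
    the usual differentiation of the Rayleigh quotient.\<close>
  define T where "T = (\<lambda>v. m *\<^sub>R v - A *v v)"
  have T_lin: "bounded_linear T"
    unfolding T_def by (intro bounded_linear_intros matrix_vector_mul_bounded_linear)
  then obtain K where K: "0 < K" "\<And>v. norm (T v) \<le> norm v * K"
    using bounded_linear.pos_bounded by blast
  have "(norm (T v0))\<^sup>2 \<le> K * (v0 \<bullet> T v0)"
  proof (rule psd_norm_le)
    show "linear T" using T_lin by (rule bounded_linear.linear)
    show "T u \<bullet> v = u \<bullet> T v" for u v
      by (simp add: T_def inner_diff_left inner_diff_right symmetric_matrix_inner[OF sym])
    show "0 \<le> v \<bullet> T v" for v
      using ray[of v] by (simp add: T_def inner_diff_right power2_norm_eq_inner)
    show "v \<bullet> T v \<le> K * (norm v)\<^sup>2" for v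
    proof -
      have "v \<bullet> T v \<le> norm v * norm (T v)" by (rule norm_cauchy_schwarz)
      also have "\<dots> \<le> norm v * (norm v * K)" by (intro mult_left_mono K) auto
      finally show ?thesis by (simp add: power2_eq_square algebra_simps)
    qed
  qed fact
  also have "v0 \<bullet> T v0 = 0"
    using v0 by (simp add: T_def inner_diff_right m_def flip: power2_norm_eq_inner)
  finally have "A *v v0 = m *\<^sub>R v0"
    by (simp add: T_def)
  then have ev: "is_eigenvalue A m"
    using v0 unfolding is_eigenvalue_def by (metis norm_zero zero_neq_one)
  have "lambda_max A = m"
    unfolding lambda_max_def
  proof (rule Greatest_equality)
    show "is_eigenvalue A m" by (rule ev)
  next
    fix l assume "is_eigenvalue A l"
    then obtain v where "v \<noteq> 0" "A *v v = l *\<^sub>R v" by (auto simp: is_eigenvalue_def)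
    with ray[of v] show "l \<le> m" by (simp flip: power2_norm_eq_inner)
  qed
  with ev ray show "is_eigenvalue A (lambda_max A)" "v \<bullet> (A *v v) \<le> lambda_max A * (norm v)\<^sup>2"
    by simp_all
qed

lemma eigenvalue_le_lambda_max:
  fixes A :: "real^'n^'n"
  assumes "transpose A = A" "is_eigenvalue A l"
  shows "l \<le> lambda_max A"
proof -
  obtain v where "v \<noteq> 0" "A *v v = l *\<^sub>R v" using assms(2) by (auto simp: is_eigenvalue_def)
  with inner_le_lambda_max[OF assms(1), of v] show ?thesis
    by (simp flip: power2_norm_eq_inner)
qed

section \<open>Moore-Penrose inverses of matrices whose kernel consists of the constant
  vectors\<close>

definition penrose :: "real^'n^'n \<Rightarrow> real^'n^'n \<Rightarrow> bool" where
  "penrose A B \<longleftrightarrow> A ** B ** A = A \<and> B ** A ** B = B \<and>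
     transpose (A ** B) = A ** B \<and> transpose (B ** A) = B ** A"

text \<open>\<open>A ** B\<close> and \<open>A ** C\<close> are orthogonal projections onto the same
  range, hence equal, and likewise \<open>B ** A\<close> and \<open>C ** A\<close>; then
  \<open>B = B ** A ** B\<close> can be rewritten into \<open>C ** A ** C\<close>.\<close>

lemma penrose_unique:
  fixes A :: "real^'n^'n"
  assumes B: "penrose A B" and C: "penrose A C"
  shows "B = C"
proof -
  note b = B[unfolded penrose_def] and c = C[unfolded penrose_def]
  have "A ** B = transpose (A ** B)" using b by simp
  also have "\<dots> = transpose (A ** C ** A ** B)" using c by simp
  also have "\<dots> = transpose (A ** B) ** transpose (A ** C)"
    by (simp add: matrix_mul_assoc flip: matrix_transpose_mul)
  also have "\<dots> = A ** B ** A ** C" using b c by (simp add: matrix_mul_assoc)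
  finally have 1: "A ** B = A ** C" using b by simp
  have "B ** A = transpose (B ** A)" using b by simp
  also have "\<dots> = transpose (B ** (A ** C ** A))" using c by simp
  also have "\<dots> = transpose (C ** A) ** transpose (B ** A)"
    by (simp add: matrix_mul_assoc flip: matrix_transpose_mul)
  also have "\<dots> = C ** A ** (B ** A)" using b c by simp
  also have "\<dots> = C ** (A ** B ** A)" by (simp only: matrix_mul_assoc)
  finally have 2: "B ** A = C ** A" using b by simp
  have "B = B ** A ** B" using b by simp
  also have "\<dots> = C ** (A ** B)" using 2 by (simp add: matrix_mul_assoc)
  also have "\<dots> = C" using 1 c by (simp add: matrix_mul_assoc)
  finally show ?thesis .
qed

lemma pseudoinverse_eqI: "penrose A B \<Longrightarrow> pseudoinverse A = B"
  unfolding pseudoinverse_def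
  by (rule the_equality) (auto simp: penrose_def intro!: penrose_unique)

text \<open>The orthogonal projection onto the constant vectors, which form the kernel of
  \<open>I - W\<close> for a mixing matrix \<open>W\<close>.\<close>

definition averaging :: "real^'n^'n" where
  "averaging = (\<chi> i j. 1 / real CARD('n))"

lemma averaging_mult_nth: "(averaging ** X) $ i = (1 / real CARD('n)) *\<^sub>R (\<Sum>j\<in>UNIV. X $ j)"
  for X :: "real^'d^'n"
  by (simp add: vec_eq_iff averaging_def matrix_matrix_mult_def sum_divide_distrib)

lemma averaging_mult_vector: "averaging *v v = (\<chi> i. (\<Sum>j\<in>UNIV. v $ j) / real CARD('n))"
  for v :: "real^'n"
  by (simp add: vec_eq_iff averaging_def matrix_vector_mult_def sum_divide_distrib)

lemma transpose_averaging: "transpose averaging = averaging"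
  by (simp add: averaging_def transpose_def)

lemma averaging_idem: "averaging ** averaging = averaging"
  by (simp add: averaging_def vec_eq_iff matrix_matrix_mult_def)

text \<open>The properties of \<open>I - W\<close> behind the pseudoinverse. The last two
  assumptions together say that the kernel is exactly the range of \<open>averaging\<close>, one
  inclusion each.\<close>

locale averaging_kernel =
  fixes A :: "real^'n^'n"
  assumes sym: "transpose A = A"
    and psd: "0 \<le> v \<bullet> (A *v v)"
    and mult_averaging: "A ** averaging = 0"
    and kernel: "A *v v = 0 \<Longrightarrow> averaging *v v = v"
begin

lemma averaging_mult: "averaging ** A = 0"
  using arg_cong[OF mult_averaging, of transpose]
  by (simp add: matrix_transpose_mul transpose_averaging sym) (simp add: transpose_def zero_vec_def)

text \<open>Adding the projection onto the kernel makes \<open>A\<close> invertible. The inverse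
  \<open>B\<close> of \<open>A + averaging\<close> inverts \<open>A\<close> on the range of
  \<open>A\<close> and is the identity on the constants; subtracting \<open>averaging\<close>
  removes the latter part.\<close>

lemma penrose_exists:
  obtains P where "penrose A P" "P ** A = mat 1 - averaging" "transpose P = P"
proof -
  let ?N = "averaging :: real^'n^'n"
  \<comment> \<open>Applying the projection to the equation kills \<open>A *v v\<close>, so both
    summands vanish separately.\<close>
  have inj: "v = 0" if "(A + ?N) *v v = 0" for v
  proof -
    have 0: "A *v v + ?N *v v = 0"
      using that by (simp add: matrix_vector_mult_add_rdistrib)
    have "?N *v (A *v v + ?N *v v) = (?N ** A) *v v + (?N ** ?N) *v v"
      by (simp add: matrix_vector_right_distrib matrix_vector_mul_assoc)
    then have "?N *v v = 0" using 0 by (simp add: averaging_mult averaging_idem)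
    with 0 kernel show ?thesis by simp
  qed
  have add_l: "(X + Y) ** Z = X ** Z + Y ** Z"
    and sub_l: "(X - Y) ** Z = X ** Z - Y ** Z" and sub_r: "Z ** (X - Y) = Z ** X - Z ** Y"
    for X Y Z :: "real^'n^'n"
    by (simp_all add: vec_eq_iff matrix_matrix_mult_def sum.distrib sum_subtractf algebra_simps)
  obtain B where B: "B ** (A + ?N) = mat 1"
    using inj matrix_left_invertible_ker[of "A + ?N"] by blast
  then have B': "(A + ?N) ** B = mat 1"
    using matrix_left_right_inverse by blast
  have AN: "(A + ?N) ** ?N = ?N" "?N ** (A + ?N) = ?N"
    by (simp_all add: add_l matrix_add_ldistrib mult_averaging averaging_mult averaging_idem)
  have BN: "B ** ?N = ?N"
    using B AN(1) by (metis matrix_mul_assoc matrix_mul_lid)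
  have NB: "?N ** B = ?N"
    using B' AN(2) by (metis matrix_mul_assoc matrix_mul_rid)
  have AB: "A ** B = mat 1 - ?N" using B' NB by (simp add: add_l eq_diff_eq)
  have BA: "B ** A = mat 1 - ?N" using B BN by (simp add: matrix_add_ldistrib eq_diff_eq)
  have "transpose B ** (A + ?N) = mat 1"
    using arg_cong[OF B', of transpose]
    by (simp add: matrix_transpose_mul transpose_mat transpose_averaging sym)
      (metis (no_types, lifting) plus_vec_def sym transpose_averaging transpose_def vec_eq_iff vec_lambda_beta vector_add_component)
  then have tB: "transpose B = B"
    using B' by (metis matrix_mul_assoc matrix_mul_lid matrix_mul_rid)
  have tsub: "transpose (X - Y) = transpose X - transpose Y" for X Y :: "real^'n^'n"
    by (simp add: vec_eq_iff transpose_def)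
  define P where "P = B - ?N"
  have PA: "P ** A = mat 1 - ?N" by (simp add: P_def sub_l BA averaging_mult)
  have AP: "A ** P = mat 1 - ?N" by (simp add: P_def sub_r AB mult_averaging)
  have "penrose A P"
    unfolding penrose_def PA AP
    by (simp add: sub_l tsub transpose_mat transpose_averaging averaging_mult)
       (simp add: P_def sub_r NB averaging_idem)
  moreover have "transpose P = P" by (simp add: P_def tsub tB transpose_averaging)
  ultimately show ?thesis using PA that by blast
qed

lemma
  shows penrose_pseudoinverse: "penrose A (pseudoinverse A)"
    and pseudoinverse_mult: "pseudoinverse A ** A = mat 1 - averaging"
    and transpose_pseudoinverse: "transpose (pseudoinverse A) = pseudoinverse A"
  using penrose_exists pseudoinverse_eqI by metis+

text \<open>From \<open>P = P ** A ** P\<close> and the symmetry of \<open>P\<close>, the form of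
  \<open>P\<close> at \<open>v\<close> is the form of \<open>A\<close> at
  \<open>P *v v\<close>.\<close>

lemma pseudoinverse_psd: "0 \<le> v \<bullet> (pseudoinverse A *v v)"
proof -
  let ?P = "pseudoinverse A"
  have "v \<bullet> (?P *v v) = v \<bullet> (?P *v (A *v (?P *v v)))"
    using penrose_pseudoinverse by (simp add: penrose_def matrix_vector_mul_assoc matrix_mul_assoc)
  also have "\<dots> = (?P *v v) \<bullet> (A *v (?P *v v))"
    by (simp add: symmetric_matrix_inner[OF transpose_pseudoinverse])
  also have "0 \<le> \<dots>" by (rule psd)
  finally show ?thesis .
qed

lemma lambda_max_nonneg: "0 \<le> lambda_max A"
proof -
  obtain v where v: "v \<noteq> 0" "A *v v = lambda_max A *\<^sub>R v"
    using is_eigenvalue_lambda_max[OF sym] by (auto simp: is_eigenvalue_def)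
  then have "0 \<le> lambda_max A * (norm v)\<^sup>2" using psd[of v] by (simp add: power2_norm_eq_inner)
  with v show ?thesis by (simp add: zero_le_mult_iff)
qed

text \<open>An eigenvector for a nonzero eigenvalue has average zero, so the pseudoinverse really
  inverts \<open>A\<close> on it and has the reciprocal eigenvalue. The positivity matters because
  this number is a denominator in \<open>\<theta>\<^sub>1\<close>.\<close>

lemma lambda_max_pseudoinverse_pos:
  assumes "0 < lambda_max A"
  shows "0 < lambda_max (pseudoinverse A)"
proof -
  let ?b = "lambda_max A"
  obtain v where v: "v \<noteq> 0" "A *v v = ?b *\<^sub>R v"
    using is_eigenvalue_lambda_max[OF sym] by (auto simp: is_eigenvalue_def)
  have "(averaging ** A) *v v = ?b *\<^sub>R (averaging *v v)"
    using v by (simp add: matrix_vector_mult_scaleR flip: matrix_vector_mul_assoc)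
  then have "averaging *v v = 0" using assms by (simp add: averaging_mult)
  then have "(pseudoinverse A ** A) *v v = v"
    by (simp add: pseudoinverse_mult matrix_vector_mult_diff_rdistrib)
  then have "?b *\<^sub>R (pseudoinverse A *v v) = v"
    using v by (simp add: matrix_vector_mult_scaleR flip: matrix_vector_mul_assoc)
  then have "(1 / ?b) *\<^sub>R (?b *\<^sub>R (pseudoinverse A *v v)) = (1 / ?b) *\<^sub>R v" by simp
  then have "pseudoinverse A *v v = (1 / ?b) *\<^sub>R v" using assms by simp
  then have "is_eigenvalue (pseudoinverse A) (1 / ?b)"
    using v unfolding is_eigenvalue_def by blast
  from eigenvalue_le_lambda_max[OF transpose_pseudoinverse this] assms show ?thesis
    by (smt (verit) divide_pos_pos)
qed

end

section \<open>Mixing matrices: the Laplacian \<open>I - W\<close>, its Dirichlet form and its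
  kernel\<close>

lemma laplacian_quadratic_form:
  fixes W :: "real^'n^'n"
  assumes "transpose W = W" "doubly_stochastic W"
  shows "v \<bullet> ((mat 1 - W) *v v) = (\<Sum>i\<in>UNIV. \<Sum>j\<in>UNIV. W $ i $ j * (v $ i - v $ j)\<^sup>2) / 2"
proof -
  have r: "(\<Sum>j\<in>UNIV. W $ i $ j) = 1" and c: "(\<Sum>i\<in>UNIV. W $ i $ j) = 1" for i j
    using assms(2) by (auto simp: doubly_stochastic_def)
  have "(\<Sum>i\<in>UNIV. \<Sum>j\<in>UNIV. W $ i $ j * (v $ i - v $ j)\<^sup>2)
      = (\<Sum>i\<in>UNIV. \<Sum>j\<in>UNIV. W $ i $ j * (v $ i)\<^sup>2) + (\<Sum>i\<in>UNIV. \<Sum>j\<in>UNIV. W $ i $ j * (v $ j)\<^sup>2)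
        - 2 * (\<Sum>i\<in>UNIV. \<Sum>j\<in>UNIV. W $ i $ j * (v $ i) * (v $ j))"
    by (simp add: power2_diff algebra_simps sum.distrib sum_subtractf sum_distrib_left)
  also have "(\<Sum>i\<in>UNIV. \<Sum>j\<in>UNIV. W $ i $ j * (v $ i)\<^sup>2) = (\<Sum>i\<in>UNIV. (v $ i)\<^sup>2)"
    by (simp add: r flip: sum_distrib_right)
  also have "(\<Sum>i\<in>UNIV. \<Sum>j\<in>UNIV. W $ i $ j * (v $ j)\<^sup>2) = (\<Sum>i\<in>UNIV. (v $ i)\<^sup>2)"
    by (subst sum.swap) (simp add: c flip: sum_distrib_right)
  finally show ?thesis
    by (simp add: matrix_vector_mult_diff_rdistrib inner_diff_right)
       (simp add: inner_vec_def matrix_vector_mult_def power2_eq_square sum_distrib_left algebra_simps)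
qed

lemma matpow_Suc: "matpow A (Suc m) = A ** matpow A m"
  by (simp add: matpow_def)

lemma matpow_row_sum:
  assumes "\<And>i. (\<Sum>j\<in>UNIV. W $ i $ j) = (1::real)"
  shows "(\<Sum>j\<in>UNIV. matpow W m $ i $ j) = 1"
proof (induction m arbitrary: i)
  case 0
  then show ?case by (simp add: matpow_def mat_def)
next
  case (Suc m)
  have "(\<Sum>j\<in>UNIV. matpow W (Suc m) $ i $ j) = (\<Sum>k\<in>UNIV. \<Sum>j\<in>UNIV. W $ i $ k * matpow W m $ k $ j)"
    by (subst sum.swap) (simp add: matpow_Suc matrix_matrix_mult_def)
  also have "\<dots> = 1" by (simp add: Suc assms flip: sum_distrib_left)
  finally show ?case .
qed

lemma matpow_fixed: "W *v v = v \<Longrightarrow> matpow W m *v v = v"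
  by (induction m) (simp_all add: matpow_Suc, simp add: matpow_def, metis matrix_vector_mul_assoc)

text \<open>Maximum principle: at an index where a fixed vector of a positive stochastic power is
  maximal, that entry is a strictly positive average of all entries.\<close>

lemma primitive_fixed_const:
  fixes W :: "real^'n^'n"
  assumes "primitive_matrix W" and rs: "\<And>i. (\<Sum>j\<in>UNIV. W $ i $ j) = 1" and fp: "W *v v = v"
  shows "v $ i = v $ j"
proof -
  obtain m where pos: "\<And>i j. 0 < matpow W m $ i $ j"
    using assms(1) by (auto simp: primitive_matrix_def)
  obtain k where k: "\<And>j. v $ j \<le> v $ k"
    using Max_ge[of "range (($) v)"] Max_in[of "range (($) v)"] by fastforce
  have "v $ k = (\<Sum>j\<in>UNIV. matpow W m $ k $ j * v $ j)"
    using arg_cong[OF matpow_fixed[OF fp, of m], of "\<lambda>w. w $ k"] by (simp add: matrix_vector_mult_def)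
  moreover have "v $ k = (\<Sum>j\<in>UNIV. matpow W m $ k $ j * v $ k)"
    by (simp add: matpow_row_sum[OF rs] flip: sum_distrib_right)
  ultimately have "(\<Sum>j\<in>UNIV. matpow W m $ k $ j * (v $ k - v $ j)) = 0"
    by (simp add: algebra_simps sum_subtractf)
  moreover have "0 \<le> matpow W m $ k $ j * (v $ k - v $ j)" for j
    using pos[of k j] k[of j] by simp
  ultimately have "matpow W m $ k $ j * (v $ k - v $ j) = 0" for j
    by (simp add: sum_nonneg_eq_0_iff)
  then have "v $ j = v $ k" for j using pos[of k j] by (metis eq_iff_diff_eq_0 less_irrefl mult_eq_0_iff)
  then show ?thesis by metis
qed

lemma mixing_matrix_averaging_kernel:
  fixes W :: "real^'n^'n"
  assumes "mixing_matrix E W"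
  shows "averaging_kernel (mat 1 - W)"
proof
  have sym: "transpose W = W" and ds: "doubly_stochastic W" and pr: "primitive_matrix W"
    using assms by (auto simp: mixing_matrix_def)
  show "transpose (mat 1 - W) = mat 1 - W"
    using sym by (simp add: vec_eq_iff transpose_def mat_def) 
  show "0 \<le> v \<bullet> ((mat 1 - W) *v v)" for v
    unfolding laplacian_quadratic_form[OF sym ds]
    using ds by (intro divide_nonneg_pos sum_nonneg mult_nonneg_nonneg) (auto simp: doubly_stochastic_def)
  have r: "(\<Sum>j\<in>UNIV. W $ i $ j) = 1" for i
    using ds by (auto simp: doubly_stochastic_def)
  show "(mat 1 - W) ** averaging = 0"
    by (simp add: vec_eq_iff matrix_matrix_mult_def averaging_def mat_def left_diff_distrib sum_subtractf r
        flip: sum_distrib_right sum_divide_distrib)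
  show "averaging *v v = v" if "(mat 1 - W) *v v = 0" for v
  proof -
    have "W *v v = v" using that by (simp add: matrix_vector_mult_diff_rdistrib)
    then have "v $ j = v $ i" for i j by (rule primitive_fixed_const[OF pr r])
    then have eq: "(\<Sum>j\<in>UNIV. v $ j) = (\<Sum>j\<in>(UNIV :: 'n set). v $ i)" for i
      by (intro sum.cong) auto
    have "(averaging *v v) $ i = v $ i" for i
      unfolding averaging_mult_vector vec_lambda_beta by (subst eq[of i]) simp
    then show ?thesis by (simp add: vec_eq_iff)
  qed
qed

section \<open>Lifting to arrays: \<open>A ** X\<close> acts on each column of \<open>X\<close>
  separately\<close>

lemma inner_matrix_columns: "X \<bullet> Y = (\<Sum>c\<in>UNIV. column c X \<bullet> column c Y)" for X Y :: "real^'d^'n"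
  unfolding inner_vec_def column_def by (subst sum.swap) simp

lemma column_matrix_mult: "column c (A ** X) = A *v column c X" for X :: "real^'d^'n"
  by (simp add: column_def matrix_matrix_mult_def matrix_vector_mult_def vec_eq_iff)

lemma norm_matrix_columns: "(norm X)\<^sup>2 = (\<Sum>c\<in>UNIV. (norm (column c X))\<^sup>2)" for X :: "real^'d^'n"
  by (simp add: power2_norm_eq_inner inner_matrix_columns[of X X])

lemma matrix_mult_inner_sym:
  fixes A :: "real^'n^'n" and X Y :: "real^'d^'n"
  assumes "transpose A = A"
  shows "(A ** X) \<bullet> Y = X \<bullet> (A ** Y)"
  by (simp add: inner_matrix_columns column_matrix_mult symmetric_matrix_inner[OF assms])

lemma matrix_mult_inner_nonneg:
  fixes A :: "real^'n^'n" and X :: "real^'d^'n"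
  assumes "\<And>v. 0 \<le> v \<bullet> (A *v v)"
  shows "0 \<le> X \<bullet> (A ** X)"
  by (simp add: inner_matrix_columns column_matrix_mult assms sum_nonneg)

lemma matrix_mult_inner_le_lambda_max:
  fixes A :: "real^'n^'n" and X :: "real^'d^'n"
  assumes "transpose A = A"
  shows "X \<bullet> (A ** X) \<le> lambda_max A * (norm X)\<^sup>2"
  by (simp add: inner_matrix_columns column_matrix_mult norm_matrix_columns sum_distrib_left
      sum_mono inner_le_lambda_max[OF assms])

lemma bounded_linear_matrix_mult: "bounded_linear (\<lambda>X. A ** X)"
  for A :: "real^'n^'m" and X :: "real^'d^'n"
  by (intro linear_conv_bounded_linear[THEN iffD1] linearI)
     (simp_all add: vec_eq_iff matrix_matrix_mult_def sum_distrib_left sum.distrib algebra_simps)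

section \<open>The deterministic Lyapunov inequality and its recursion\<close>

lemma strongly_monotone_gradient:
  assumes "smooth_strongly_convex f gf L \<mu>"
  shows "\<mu> * (norm (x - y))\<^sup>2 \<le> (gf x - gf y) \<bullet> (x - y)"
proof -
  have "f y + gf y \<bullet> (x - y) + \<mu> / 2 * (norm (x - y))\<^sup>2 \<le> f x"
    "f x + gf x \<bullet> (y - x) + \<mu> / 2 * (norm (y - x))\<^sup>2 \<le> f y"
    using assms unfolding smooth_strongly_convex_def by auto
  then show ?thesis
    by (simp add: norm_minus_commute inner_diff_left inner_diff_right algebra_simps)
qed

text \<open>\<open>z\<close> is a gradient step of length \<open>1 / L\<close> from \<open>x\<close>
  for \<open>f\<close> minus its linear part at \<open>y\<close>, a convex function minimal at
  \<open>y\<close>. The decrease \<open>\<delta> \<bullet> \<delta> / (2 * L)\<close> gained by the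
  step cannot exceed the distance of that function from its minimum, which smoothness bounds by
  \<open>L / 2 * (norm (x - y))\<^sup>2\<close>.\<close>

lemma lipschitz_gradient:
  assumes f: "smooth_strongly_convex f gf L \<mu>" and "0 < \<mu>" "\<mu> \<le> L"
  shows "(norm (gf x - gf y))\<^sup>2 \<le> L\<^sup>2 * (norm (x - y))\<^sup>2"
proof -
  define \<delta> where "\<delta> = gf x - gf y"
  define z where "z = x - (1 / L) *\<^sub>R \<delta>"
  have "0 < L" using assms by linarith
  have lo: "f y + gf y \<bullet> (z - y) \<le> f z"
    using f \<open>0 < \<mu>\<close> unfolding smooth_strongly_convex_def
    by (smt (verit) divide_nonneg_nonneg mult_nonneg_nonneg zero_le_power2)
  have up: "f z \<le> f x + gf x \<bullet> (z - x) + L / 2 * (norm (z - x))\<^sup>2"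
    "f x \<le> f y + gf y \<bullet> (x - y) + L / 2 * (norm (x - y))\<^sup>2"
    using f unfolding smooth_strongly_convex_def by auto
  have zx: "z - x = - (1 / L) *\<^sub>R \<delta>" "z - y = (x - y) - (1 / L) *\<^sub>R \<delta>" by (simp_all add: z_def)
  have "\<delta> \<bullet> \<delta> / L = gf x \<bullet> \<delta> / L - gf y \<bullet> \<delta> / L"
    by (simp add: \<delta>_def inner_diff_left diff_divide_distrib)
  moreover have "L / 2 * (norm (z - x))\<^sup>2 = (\<delta> \<bullet> \<delta> / L) / 2"
    using \<open>0 < L\<close> unfolding power2_norm_eq_inner by (simp add: zx field_simps)
  moreover have "gf y \<bullet> (z - y) = gf y \<bullet> (x - y) - gf y \<bullet> \<delta> / L" "gf x \<bullet> (z - x) = - (gf x \<bullet> \<delta> / L)"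
    unfolding zx by (simp_all add: inner_diff_right)
  moreover note lo up
  moreover define a b q r where "a = gf x \<bullet> \<delta> / L" and "b = gf y \<bullet> \<delta> / L" and "q = \<delta> \<bullet> \<delta> / L"
    and "r = L / 2 * (norm (x - y))\<^sup>2"
  ultimately have "q \<le> 2 * r" unfolding a_def[symmetric] b_def[symmetric] q_def[symmetric] r_def[symmetric] by linarith
  then have "\<delta> \<bullet> \<delta> / L \<le> L * (norm (x - y))\<^sup>2" by (simp add: q_def r_def)
  then show ?thesis
    using \<open>0 < L\<close> unfolding power2_norm_eq_inner by (simp add: \<delta>_def power2_eq_square field_simps)
qed

text \<open>A step of length \<open>1 / (n * L)\<close> against the sum \<open>s\<close> of the
  gradients would lower the objective by at least \<open>s \<bullet> s / (2 * n * L)\<close>, so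
  minimality leaves only \<open>s = 0\<close>.\<close>

lemma sum_gradients_minimizer:
  fixes f :: "'n::finite \<Rightarrow> 'v::real_inner \<Rightarrow> real"
  assumes f: "\<And>i. smooth_strongly_convex (f i) (gf i) L \<mu>" and "0 < L"
    and min: "\<And>x. (\<Sum>i\<in>UNIV. f i z) \<le> (\<Sum>i\<in>UNIV. f i x)"
  shows "(\<Sum>i\<in>UNIV. gf i z) = 0"
proof -
  define n where "n = real CARD('n)"
  have "0 < n" by (simp add: n_def)
  define s where "s = (\<Sum>i\<in>UNIV. gf i z)"
  define x where "x = z - (1 / (n * L)) *\<^sub>R s"
  have "(\<Sum>i\<in>UNIV. f i x) \<le> (\<Sum>i\<in>UNIV. f i z + gf i z \<bullet> (x - z) + L / 2 * (norm (x - z))\<^sup>2)"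
    using f unfolding smooth_strongly_convex_def by (intro sum_mono) auto
  also have "\<dots> = (\<Sum>i\<in>UNIV. f i z) + s \<bullet> (x - z) + n * L / 2 * (norm (x - z))\<^sup>2"
    by (simp add: sum.distrib s_def n_def inner_sum_left)
  finally have "0 \<le> s \<bullet> (x - z) + n * L / 2 * (norm (x - z))\<^sup>2"
    using min[of x] by linarith
  also have "\<dots> = - (s \<bullet> s) / (2 * n * L)"
    using \<open>0 < n\<close> \<open>0 < L\<close> unfolding power2_norm_eq_inner by (simp add: x_def field_simps)
  finally have "s \<bullet> s \<le> 0"
    using \<open>0 < n\<close> \<open>0 < L\<close> by (simp add: divide_simps mult_le_0_iff)
  then have "s = 0" by (metis inner_gt_zero_iff not_less)
  then show ?thesis by (simp add: s_def)
qed

text \<open>Young's inequality with weight \<open>s = 8 * p\<close>: the \<open>d\<close> part then costs only a quarter of the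
  negative term \<open>- norm d ^ 2\<close> that the primal-dual identity provides.\<close>

lemma young_eighth:
  fixes a d :: "'v::real_inner"
  assumes "0 < p" "p \<le> 1 / 64"
  shows "p * (norm (a - d))\<^sup>2 \<le> 9 / 8 * p * (norm a)\<^sup>2 + (norm d)\<^sup>2 / 4"
proof -
  have "0 \<le> (norm ((8 * p) *\<^sub>R a + d))\<^sup>2" by simp
  also have "(norm ((8 * p) *\<^sub>R a + d))\<^sup>2 = 64 * p\<^sup>2 * (norm a)\<^sup>2 + 16 * p * (a \<bullet> d) + (norm d)\<^sup>2"
    unfolding power2_norm_eq_inner
    by (simp add: inner_add_left inner_add_right inner_commute power2_eq_square algebra_simps)
  finally have 1: "- (2 * p * (a \<bullet> d)) \<le> 8 * p\<^sup>2 * (norm a)\<^sup>2 + (norm d)\<^sup>2 / 8" by linarith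
  have "8 * p\<^sup>2 \<le> p / 8" using assms by (simp add: power2_eq_square)
  then have 2: "8 * p\<^sup>2 * (norm a)\<^sup>2 \<le> p / 8 * (norm a)\<^sup>2" by (intro mult_right_mono) auto
  have 3: "p * (norm d)\<^sup>2 \<le> 1/64 * (norm d)\<^sup>2" using assms by (intro mult_right_mono) auto
  have "p * (norm (a - d))\<^sup>2 = p * (norm a)\<^sup>2 - 2 * p * (a \<bullet> d) + p * (norm d)\<^sup>2"
    by (simp add: power2_norm_eq_inner inner_diff_left inner_diff_right inner_commute algebra_simps)
  also have "\<dots> \<le> p * (norm a)\<^sup>2 + (p / 8 * (norm a)\<^sup>2 + (norm d)\<^sup>2 / 8) + 1/64 * (norm d)\<^sup>2"
    using 1 2 3 by linarith
  also have "\<dots> \<le> 9 / 8 * p * (norm a)\<^sup>2 + (norm d)\<^sup>2 / 4"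
    using zero_le_power2[of "norm d"] by linarith
  finally show ?thesis .
qed

section \<open>One LEAD step for fixed noise, with \<open>A\<close> for \<open>I - W\<close> and
  \<open>B\<close> for its pseudoinverse\<close>

locale laplacian_pair =
  fixes A B :: "'v::real_inner \<Rightarrow> 'v" and \<beta> \<kappa> :: real
  assumes linA: "linear A" and linB: "linear B"
    and symA: "A u \<bullet> v = u \<bullet> A v" and symB: "B u \<bullet> v = u \<bullet> B v"
    and psdA: "0 \<le> v \<bullet> A v" and psdB: "0 \<le> v \<bullet> B v"
    and A_le: "v \<bullet> A v \<le> \<beta> * (norm v)\<^sup>2" and B_le: "v \<bullet> B v \<le> \<kappa> * (norm v)\<^sup>2"
    and \<beta>_pos: "0 < \<beta>" and \<kappa>_pos: "0 < \<kappa>"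
begin

text \<open>The dual form produces the cross term \<open>2 * \<eta> * (d \<bullet> (y + e))\<close>,
  which also arises on the right from squaring \<open>xt = y + \<eta> *\<^sub>R d\<close>, together
  with a surplus \<open>\<eta>\<^sup>2 * (norm d)\<^sup>2\<close> that has to be subtracted.
  \<open>d_range\<close> and \<open>A_range\<close> state that \<open>B\<close> undoes
  \<open>A\<close> when tested against the range of \<open>A\<close>; tested against constant
  vectors this fails.\<close>

lemma primal_dual_identity:
  assumes pos: "0 < \<eta>" "0 < \<gamma>"
    and d_range: "\<And>v. d \<bullet> B (A v) = d \<bullet> v" and A_range: "\<And>u v. A u \<bullet> B (A v) = A u \<bullet> v"
    and y: "y = xt - \<eta> *\<^sub>R d" and d': "d' = d + (\<gamma> / (2 * \<eta>)) *\<^sub>R A (y + e)"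
    and x': "x' = y - (\<gamma> / 2) *\<^sub>R A (y + e)"
  shows "(norm x')\<^sup>2 + 2 * \<eta>\<^sup>2 / \<gamma> * (d' \<bullet> B d') =
    (norm xt)\<^sup>2 + 2 * \<eta>\<^sup>2 / \<gamma> * (d \<bullet> B d) - \<eta>\<^sup>2 * (norm d)\<^sup>2 + \<gamma>\<^sup>2 / 4 * (norm (A (y + e)))\<^sup>2
    + 2 * \<eta> * (d' \<bullet> e) - \<gamma> / 2 * ((y + e) \<bullet> A (y + e))"
proof -
  define v where "v = y + e"
  define a where "a = A v"
  define c where "c = \<gamma> / (2 * \<eta>)"
  have "a \<bullet> B d = d \<bullet> v" using d_range[of v] by (metis a_def symB inner_commute)
  then have dB: "d' \<bullet> B d' = d \<bullet> B d + 2 * c * (d \<bullet> v) + c\<^sup>2 * (a \<bullet> v)"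
    using d_range[of v] A_range[of v v]
    unfolding d' v_def[symmetric] a_def[symmetric] c_def[symmetric]
    by (simp add: linear_add[OF linB] linear_scale[OF linB] inner_add_left inner_add_right
        power2_eq_square algebra_simps)
  have xt: "xt = v - e + \<eta> *\<^sub>R d" and x'': "x' = v - e - (\<gamma> / 2) *\<^sub>R a" and d'': "d' = d + c *\<^sub>R a"
    by (simp_all add: y x' d' v_def a_def c_def)
  have 1: "2 * \<eta>\<^sup>2 / \<gamma> * (d' \<bullet> B d') = 2 * \<eta>\<^sup>2 / \<gamma> * (d \<bullet> B d) + 2 * \<eta> * (d \<bullet> v) + \<gamma> / 2 * (a \<bullet> v)"
    using pos unfolding dB c_def by (simp add: power2_eq_square field_simps)
  have 2: "2 * \<eta> * (d' \<bullet> e) = 2 * \<eta> * (d \<bullet> e) + \<gamma> * (a \<bullet> e)"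
    using pos unfolding d'' c_def by (simp add: inner_add_left field_simps)
  show ?thesis
    unfolding 1 2 unfolding v_def[symmetric] a_def[symmetric] xt x'' power2_norm_eq_inner
    by (simp add: inner_add_left inner_add_right inner_diff_left inner_diff_right inner_commute
        power2_eq_square field_simps)
qed

text \<open>Since \<open>2 * (1 + C) * \<alpha> = p\<close>, the convex combination in
  \<open>h'\<close> yields \<open>p * (norm y)\<^sup>2\<close> and
  \<open>- p * (1 - \<alpha>) * (norm (y - h))\<^sup>2\<close>. Everything linear in the compression
  error \<open>e\<close> is collected in \<open>b\<close>, which involves only vectors known before
  compression, so that it can disappear in expectation.\<close>

lemma lyapunov_step:
  assumes pos: "0 < \<eta>" "0 < \<gamma>" "0 \<le> C" and small: "\<gamma> * \<beta> \<le> 2"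
    and \<alpha>: "\<alpha> = C * \<beta> * \<gamma> / (2 * (1 + C))" and p: "p = C * \<beta> * \<gamma>"
    and d_range: "\<And>v. d \<bullet> B (A v) = d \<bullet> v" and A_range: "\<And>u v. A u \<bullet> B (A v) = A u \<bullet> v"
    and y: "y = xt - \<eta> *\<^sub>R d" and d': "d' = d + (\<gamma> / (2 * \<eta>)) *\<^sub>R A (y + e)"
    and x': "x' = y - (\<gamma> / 2) *\<^sub>R A (y + e)" and h': "h' = (1 - \<alpha>) *\<^sub>R h + \<alpha> *\<^sub>R (y + e)"
    and b: "b = (2 * \<eta>) *\<^sub>R d + (\<gamma>\<^sup>2 * \<beta> / 2) *\<^sub>R A y + (2 * p) *\<^sub>R ((1 - \<alpha>) *\<^sub>R h + \<alpha> *\<^sub>R y)"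
  shows "(norm x')\<^sup>2 + 2 * \<eta>\<^sup>2 / \<gamma> * (d' \<bullet> B d') + 2 * (1 + C) * (norm h')\<^sup>2 \<le>
    (norm xt)\<^sup>2 + 2 * \<eta>\<^sup>2 / \<gamma> * (d \<bullet> B d) - \<eta>\<^sup>2 * (norm d)\<^sup>2 + 2 * (1 + C) * (1 - \<alpha>) * (norm h)\<^sup>2
    + p * (norm y)\<^sup>2 - p * (1 - \<alpha>) * (norm (y - h))\<^sup>2
    + (\<gamma> * \<beta> / 2 * (1 + \<gamma> * \<beta> / 2) + p * \<alpha>) * (norm e)\<^sup>2 + b \<bullet> e"
proof -
  have p\<alpha>: "p = 2 * (1 + C) * \<alpha>" using pos by (simp add: p \<alpha>)
  have A_add: "A (u + v) = A u + A v" for u v by (rule linear_add[OF linA])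
  \<comment> \<open>What is left of the coefficient \<open>\<gamma> / 2\<close> after
    \<open>psd_norm_le\<close> has bounded the squared norm of \<open>A (y + e)\<close> by \<beta>
    times the form; \<open>small\<close> keeps it nonnegative.\<close>
  define q where "q = \<gamma> / 2 * (1 - \<gamma> * \<beta> / 2)"
  have "0 \<le> q" using pos small by (simp add: q_def)
  have "\<gamma>\<^sup>2 / 4 * (norm (A (y + e)))\<^sup>2 \<le> \<gamma>\<^sup>2 / 4 * (\<beta> * ((y + e) \<bullet> A (y + e)))"
    by (intro mult_left_mono psd_norm_le[OF linA symA psdA A_le \<beta>_pos]) auto
  then have "\<gamma>\<^sup>2 / 4 * (norm (A (y + e)))\<^sup>2 - \<gamma> / 2 * ((y + e) \<bullet> A (y + e)) \<le> - q * ((y + e) \<bullet> A (y + e))"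
    by (simp add: q_def power2_eq_square algebra_simps)
  also have "\<dots> = - (q * (y \<bullet> A y)) - 2 * q * (A y \<bullet> e) - q * (e \<bullet> A e)"
    using symA[of y e] by (simp add: A_add inner_add_left inner_add_right inner_commute algebra_simps)
  also have "\<dots> \<le> - 2 * q * (A y \<bullet> e) - q * (e \<bullet> A e)"
    using \<open>0 \<le> q\<close> psdA[of y] by simp
  finally have 1: "\<gamma>\<^sup>2 / 4 * (norm (A (y + e)))\<^sup>2 - \<gamma> / 2 * ((y + e) \<bullet> A (y + e))
      \<le> - 2 * q * (A y \<bullet> e) - q * (e \<bullet> A e)" .
  have 2: "2 * \<eta> * (d' \<bullet> e) = 2 * \<eta> * (d \<bullet> e) + \<gamma> * (A y \<bullet> e) + \<gamma> * (e \<bullet> A e)"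
    using pos by (simp add: d' A_add inner_add_left inner_commute[of e "A e"] field_simps)
  \<comment> \<open>The total coefficient of \<open>e \<bullet> A e\<close>: \<gamma> comes from
    \<open>2 * \<eta> * (d' \<bullet> e)\<close>, because \<open>d'\<close> itself contains
    \<open>A e\<close>, and \<open>- q\<close> from the estimate \<open>1\<close>.\<close>
  have "(\<gamma> - q) * (e \<bullet> A e) \<le> (\<gamma> - q) * (\<beta> * (norm e)\<^sup>2)"
    using pos mult_pos_pos[OF pos(2) \<beta>_pos] by (intro mult_left_mono A_le) (simp add: q_def)
  moreover have "(\<gamma> - q) * \<beta> = \<gamma> * \<beta> / 2 * (1 + \<gamma> * \<beta> / 2)"
    by (simp add: q_def algebra_simps)
  ultimately have 3: "(\<gamma> - q) * (e \<bullet> A e) \<le> \<gamma> * \<beta> / 2 * (1 + \<gamma> * \<beta> / 2) * (norm e)\<^sup>2"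
    by (metis mult.assoc)
  define z where "z = (1 - \<alpha>) *\<^sub>R h + \<alpha> *\<^sub>R y"
  have h'z: "h' = z + \<alpha> *\<^sub>R e" by (simp add: h' z_def algebra_simps)
  have "(norm h')\<^sup>2 = (norm z)\<^sup>2 + 2 * \<alpha> * (z \<bullet> e) + \<alpha>\<^sup>2 * (norm e)\<^sup>2"
    unfolding h'z power2_norm_eq_inner
    by (simp add: inner_add_left inner_add_right inner_commute power2_eq_square algebra_simps)
  moreover have "(norm z)\<^sup>2 = (1 - \<alpha>) * (norm h)\<^sup>2 + \<alpha> * (norm y)\<^sup>2 - \<alpha> * (1 - \<alpha>) * (norm (y - h))\<^sup>2"
    unfolding z_def power2_norm_eq_inner
    by (simp add: inner_add_left inner_add_right inner_diff_left inner_diff_right inner_commute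
        power2_eq_square algebra_simps)
  moreover have "2 * (1 + C) * (u + 2 * \<alpha> * (z \<bullet> e) + \<alpha>\<^sup>2 * w) = 2 * (1 + C) * u + 2 * p * (z \<bullet> e) + p * \<alpha> * w"
    "2 * (1 + C) * ((1 - \<alpha>) * u + \<alpha> * w - \<alpha> * (1 - \<alpha>) * t) =
      2 * (1 + C) * (1 - \<alpha>) * u + p * w - p * (1 - \<alpha>) * t" for u w t
    by (simp_all add: p\<alpha> power2_eq_square algebra_simps)
  ultimately have 4: "2 * (1 + C) * (norm h')\<^sup>2 = 2 * (1 + C) * (1 - \<alpha>) * (norm h)\<^sup>2 + p * (norm y)\<^sup>2
      - p * (1 - \<alpha>) * (norm (y - h))\<^sup>2 + 2 * p * (z \<bullet> e) + p * \<alpha> * (norm e)\<^sup>2"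
    by simp
  have 5: "b \<bullet> e = 2 * \<eta> * (d \<bullet> e) + (\<gamma> - 2 * q) * (A y \<bullet> e) + 2 * p * (z \<bullet> e)"
    unfolding b z_def[symmetric] by (simp add: inner_add_left q_def power2_eq_square algebra_simps)
  show ?thesis
    unfolding primal_dual_identity[OF pos(1,2) d_range A_range y d' x'] 2 4 5
    using 1 3 by (simp add: algebra_simps)
qed

end

section \<open>Scalar tools: a recursion of Chung type, and complexity from a rate\<close>

lemma chung_recursion:
  fixes a :: "nat \<Rightarrow> real"
  assumes "0 < b" "0 \<le> B" and k0: "3 / 2 \<le> real k0 + b"
    and step: "\<And>k. k0 \<le> k \<Longrightarrow> a (Suc k) \<le> (1 - 3 / 2 / (real k + b)) * a k + B / (real k + b)\<^sup>2"
  obtains K where "0 \<le> K" "\<And>k. k0 \<le> k \<Longrightarrow> a k \<le> K / (real k + b)"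
proof -
  \<comment> \<open>The first entry lets the excess \<open>1 / 2\<close> of the constant
    \<open>3 / 2\<close> over \<open>1\<close> absorb the noise \<open>B\<close>; the second starts
    the induction. The assumption on \<open>k0\<close> keeps the contraction factor nonnegative, so
    that the induction hypothesis can be multiplied by it.\<close>
  define K where "K = max (2 * B) (a k0 * (real k0 + b))"
  have K: "2 * B \<le> K" "a k0 * (real k0 + b) \<le> K" by (auto simp: K_def)
  have "a k \<le> K / (real k + b)" if "k0 \<le> k" for k
    using that
  proof (induction k rule: dec_induct)
    case base
    then show ?case using K \<open>0 < b\<close> by (simp add: pos_le_divide_eq add_nonneg_pos)
  next
    case (step k)
    define t where "t = real k + b"
    have t: "3 / 2 \<le> t" using k0 step.hyps by (simp add: t_def)
    have "a (Suc k) \<le> (1 - 3 / 2 / t) * a k + B / t\<^sup>2"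
      using assms(4) step.hyps by (simp add: t_def)
    also have "\<dots> \<le> (1 - 3 / 2 / t) * (K / t) + (K / 2) / t\<^sup>2"
      using step.IH t K by (intro add_mono mult_left_mono divide_right_mono) (auto simp: t_def)
    also have "\<dots> = K * (t - 1) / t\<^sup>2"
      using t by (simp add: power2_eq_square field_simps)
    also have "\<dots> \<le> K / (t + 1)"
    proof -
      have "K * ((t - 1) * (t + 1)) \<le> K * t\<^sup>2"
        using K \<open>0 \<le> B\<close> by (intro mult_left_mono) (auto simp: power2_eq_square algebra_simps)
      then show ?thesis using t by (simp add: field_simps)
    qed
    finally show ?case by (simp add: t_def add_ac)
  qed
  moreover have "0 \<le> K" using K \<open>0 \<le> B\<close> by linarith
  ultimately show ?thesis using that by blast
qed

lemma inverse_rate_complexity: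
  fixes e :: "nat \<Rightarrow> real"
  assumes "0 \<le> K" "0 < k0" and e: "\<And>k. k0 \<le> k \<Longrightarrow> e k \<le> K / real k"
  shows "\<exists>N :: real \<Rightarrow> nat. (\<forall>\<epsilon>>0. \<forall>k\<ge>N \<epsilon>. e k \<le> \<epsilon>) \<and> (\<lambda>\<epsilon>. real (N \<epsilon>)) \<in> O[at_right 0](\<lambda>\<epsilon>. 1 / \<epsilon>)"
proof (intro exI conjI allI impI)
  \<comment> \<open>\<open>K / \<epsilon>\<close> iterations bring \<open>K / k\<close> down to
    \<epsilon>; \<open>k0\<close> is added because the bound holds only from there on.\<close>
  let ?N = "\<lambda>\<epsilon>. k0 + nat \<lceil>K / \<epsilon>\<rceil>"
  fix \<epsilon> :: real and k assume "0 < \<epsilon>" and k: "?N \<epsilon> \<le> k"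
  have "K / \<epsilon> \<le> real (nat \<lceil>K / \<epsilon>\<rceil>)" by (rule real_nat_ceiling_ge)
  also have "\<dots> \<le> real k" using k by linarith
  finally have "K / real k \<le> \<epsilon>" using \<open>0 < \<epsilon>\<close> k \<open>0 < k0\<close> by (simp add: field_simps)
  with e[of k] k show "e k \<le> \<epsilon>" by simp
next
  let ?N = "\<lambda>\<epsilon>. k0 + nat \<lceil>K / \<epsilon>\<rceil>"
  \<comment> \<open>Near \<open>0\<close> only \<open>\<epsilon> < 1\<close> matters; there
    \<open>k0\<close> and the \<open>1\<close> lost by rounding up are at most
    \<open>k0 / \<epsilon>\<close> and \<open>1 / \<epsilon>\<close>.\<close>
  have "norm (real (?N \<epsilon>)) \<le> (real k0 + K + 1) * norm (1 / \<epsilon>)" if "0 < \<epsilon>" "\<epsilon> < 1" for \<epsilon>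
  proof -
    have "0 \<le> K / \<epsilon>" using that \<open>0 \<le> K\<close> by simp
    then have "real (?N \<epsilon>) \<le> real k0 + (K / \<epsilon> + 1)" by (simp add: of_nat_nat)
    also have "\<dots> \<le> real k0 / \<epsilon> + (K / \<epsilon> + 1 / \<epsilon>)"
      using that mult_left_le[of \<epsilon> "real k0"] by (intro add_mono) (simp_all add: pos_le_divide_eq)
    finally show ?thesis using that by (simp add: add_divide_distrib)
  qed
  then show "(\<lambda>\<epsilon>. real (?N \<epsilon>)) \<in> O[at_right 0](\<lambda>\<epsilon>. 1 / \<epsilon>)"
    by (intro bigoI[where c = "real k0 + K + 1"] eventually_at_rightI[where b = 1]) auto
qed

section \<open>Square-integrable vectors and fresh noise\<close>

text \<open>Measurability is a separate clause because integrability of the squared norm does not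
  give measurability of the vector.\<close>

definition square_integrable :: "'a measure \<Rightarrow> ('a \<Rightarrow> 'v::euclidean_space) \<Rightarrow> bool" where
  "square_integrable M u \<longleftrightarrow> u \<in> borel_measurable M \<and> integrable M (\<lambda>\<omega>. (norm (u \<omega>))\<^sup>2)"

lemma square_integrable_inner:
  assumes "square_integrable M u" "square_integrable M v"
  shows "integrable M (\<lambda>\<omega>. u \<omega> \<bullet> v \<omega>)"
proof (rule Bochner_Integration.integrable_bound)
  show "integrable M (\<lambda>\<omega>. (norm (u \<omega>))\<^sup>2 + (norm (v \<omega>))\<^sup>2)"
    using assms by (auto simp: square_integrable_def)
  show "(\<lambda>\<omega>. u \<omega> \<bullet> v \<omega>) \<in> borel_measurable M"
    using assms by (auto simp: square_integrable_def)
  have "norm (a \<bullet> b) \<le> norm ((norm a)\<^sup>2 + (norm b)\<^sup>2)" for a b :: 'b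
  proof -
    have "\<bar>a \<bullet> b\<bar> \<le> norm a * norm b" by (rule Cauchy_Schwarz_ineq2)
    also have "\<dots> \<le> (norm a)\<^sup>2 + (norm b)\<^sup>2"
      using sum_squares_bound[of "norm a" "norm b"] mult_nonneg_nonneg[OF norm_ge_zero norm_ge_zero, of a b]
      by linarith
    finally show ?thesis by simp
  qed
  then show "AE \<omega> in M. norm (u \<omega> \<bullet> v \<omega>) \<le> norm ((norm (u \<omega>))\<^sup>2 + (norm (v \<omega>))\<^sup>2)"
    by simp
qed

lemma square_integrable_norm_le:
  assumes "square_integrable M u" "v \<in> borel_measurable M"
    and le: "\<And>\<omega>. \<omega> \<in> space M \<Longrightarrow> norm (v \<omega>) \<le> B * norm (u \<omega>)"
  shows "square_integrable M v"
proof -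
  have "integrable M (\<lambda>\<omega>. (norm (v \<omega>))\<^sup>2)"
  proof (rule Bochner_Integration.integrable_bound)
    show "integrable M (\<lambda>\<omega>. B\<^sup>2 * (norm (u \<omega>))\<^sup>2)"
      using assms(1) by (simp add: square_integrable_def)
    show "(\<lambda>\<omega>. (norm (v \<omega>))\<^sup>2) \<in> borel_measurable M" using assms by measurable
    have "(norm (v \<omega>))\<^sup>2 \<le> B\<^sup>2 * (norm (u \<omega>))\<^sup>2" if "\<omega> \<in> space M" for \<omega>
      using power_mono[OF le[OF that], of 2] by (simp add: power_mult_distrib)
    then show "AE \<omega> in M. norm ((norm (v \<omega>))\<^sup>2) \<le> norm (B\<^sup>2 * (norm (u \<omega>))\<^sup>2)"
      by (intro AE_I2) simp
  qed
  with assms(2) show ?thesis by (simp add: square_integrable_def)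
qed

lemma square_integrable_add:
  assumes "square_integrable M u" "square_integrable M v"
  shows "square_integrable M (\<lambda>\<omega>. u \<omega> + v \<omega>)"
proof -
  have "integrable M (\<lambda>\<omega>. (norm (u \<omega>))\<^sup>2 + 2 * (u \<omega> \<bullet> v \<omega>) + (norm (v \<omega>))\<^sup>2)"
    using assms square_integrable_inner[OF assms] by (auto simp: square_integrable_def)
  also have "(\<lambda>\<omega>. (norm (u \<omega>))\<^sup>2 + 2 * (u \<omega> \<bullet> v \<omega>) + (norm (v \<omega>))\<^sup>2) = (\<lambda>\<omega>. (norm (u \<omega> + v \<omega>))\<^sup>2)"
    unfolding power2_norm_eq_inner by (simp add: inner_add_left inner_add_right inner_commute add_ac)
  finally show ?thesis using assms by (simp add: square_integrable_def borel_measurable_add)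
qed

lemma square_integrable_bounded_linear:
  assumes T: "bounded_linear T" and u: "square_integrable M u"
  shows "square_integrable M (\<lambda>\<omega>. T (u \<omega>))"
proof -
  obtain B where "\<And>x. norm (T x) \<le> norm x * B" using bounded_linear.bounded[OF T] by blast
  moreover have "(\<lambda>\<omega>. T (u \<omega>)) \<in> borel_measurable M"
    using u by (intro borel_measurable_continuous_on[OF linear_continuous_on[OF T]])
      (simp add: square_integrable_def)
  ultimately show ?thesis
    by (intro square_integrable_norm_le[OF u, where B = B]) (simp_all add: mult.commute)
qed

lemma square_integrable_scaleR:
  "square_integrable M u \<Longrightarrow> square_integrable M (\<lambda>\<omega>. c *\<^sub>R u \<omega>)"
  by (rule square_integrable_bounded_linear[OF bounded_linear_scaleR_right])

lemma square_integrable_diff: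
  assumes "square_integrable M u" "square_integrable M v"
  shows "square_integrable M (\<lambda>\<omega>. u \<omega> - v \<omega>)"
  using square_integrable_add[OF assms(1) square_integrable_scaleR[OF assms(2), of "-1"]] by simp

lemma (in prob_space) square_integrable_const: "square_integrable M (\<lambda>\<omega>. c)"
  by (simp add: square_integrable_def)

lemma square_integrable_cong:
  "(\<And>\<omega>. \<omega> \<in> space M \<Longrightarrow> u \<omega> = v \<omega>) \<Longrightarrow> square_integrable M u \<longleftrightarrow> square_integrable M v"
  unfolding square_integrable_def
  by (intro conj_cong measurable_cong Bochner_Integration.integrable_cong) auto

lemma bounded_linear_axis: "bounded_linear (axis i :: 'b::euclidean_space \<Rightarrow> 'b^'n)"
  by (intro linear_conv_bounded_linear[THEN iffD1] linearI) (simp_all add: vec_eq_iff axis_def)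

lemma vec_eq_sum_axis: "v = (\<Sum>i\<in>UNIV. axis i (v $ i))" for v :: "'b::real_normed_vector^'n"
  by (simp add: vec_eq_iff axis_def if_distrib cong: if_cong)

text \<open>The components are vectors rather than numbers, so \<open>u\<close> is rebuilt as a
  finite sum of the continuous embeddings \<open>axis i\<close>.\<close>

lemma borel_measurable_vec_components:
  fixes u :: "'a \<Rightarrow> ('b::euclidean_space)^'n"
  assumes "\<And>i. (\<lambda>\<omega>. u \<omega> $ i) \<in> borel_measurable M"
  shows "u \<in> borel_measurable M"
proof -
  have "(\<lambda>\<omega>. \<Sum>i\<in>UNIV. axis i (u \<omega> $ i)) \<in> borel_measurable M"
    by (intro borel_measurable_sum borel_measurable_continuous_on[OF linear_continuous_on[OF bounded_linear_axis]] assms)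
  then show ?thesis by (simp flip: vec_eq_sum_axis)
qed

lemma borel_measurable_vec_component:
  fixes u :: "'a \<Rightarrow> ('b::euclidean_space)^'n"
  shows "u \<in> borel_measurable M \<Longrightarrow> (\<lambda>\<omega>. u \<omega> $ i) \<in> borel_measurable M"
  by (rule borel_measurable_continuous_on[OF linear_continuous_on[OF bounded_linear_vec_nth]])

lemma norm_vec_square: "(norm v)\<^sup>2 = (\<Sum>i\<in>UNIV. (norm (v $ i))\<^sup>2)" for v :: "('b::real_inner)^'n"
  by (simp add: power2_norm_eq_inner inner_vec_def)

lemma square_integrable_component:
  fixes u :: "'a \<Rightarrow> ('b::euclidean_space)^'n"
  shows "square_integrable M u \<Longrightarrow> square_integrable M (\<lambda>\<omega>. u \<omega> $ i)"
  by (rule square_integrable_bounded_linear[OF bounded_linear_vec_nth])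

lemma square_integrable_components:
  fixes u :: "'a \<Rightarrow> ('b::euclidean_space)^'n"
  shows "(\<And>i. square_integrable M (\<lambda>\<omega>. u \<omega> $ i)) \<Longrightarrow> square_integrable M u"
  by (simp add: square_integrable_def norm_vec_square borel_measurable_vec_components)

text \<open>The conditional expectation given the past \<open>F\<close> is replaced by Fubini: \<open>V\<close> is independent of
  \<open>F\<close>, so the joint law of the sample point, seen through \<open>F\<close>, and \<open>V\<close> is a product measure.\<close>

lemma (in prob_space)
  fixes p :: "'a \<Rightarrow> 'k \<Rightarrow> 'v::euclidean_space"
  assumes sub: "subalgebra M F"
    and V: "V \<in> measurable M K" and law: "distr M K V = K"
    and ind: "\<And>a b. a \<in> sets F \<Longrightarrow> b \<in> sets K \<Longrightarrow>
      prob (a \<inter> (V -` b \<inter> space M)) = prob a * prob (V -` b \<inter> space M)"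
    and p: "case_prod p \<in> borel_measurable (F \<Otimes>\<^sub>M K)"
    and p1: "\<And>\<omega>. \<omega> \<in> space M \<Longrightarrow> integrable K (p \<omega>)"
    and p0: "\<And>\<omega>. \<omega> \<in> space M \<Longrightarrow> (\<integral>v. p \<omega> v \<partial>K) = 0"
    and p2: "\<And>\<omega>. \<omega> \<in> space M \<Longrightarrow> integrable K (\<lambda>v. (norm (p \<omega> v))\<^sup>2)"
    and pc: "\<And>\<omega>. \<omega> \<in> space M \<Longrightarrow> (\<integral>v. (norm (p \<omega> v))\<^sup>2 \<partial>K) \<le> c \<omega>"
    and c: "integrable M c" "c \<in> borel_measurable F"
  shows fresh_noise_square_integrable: "square_integrable M (\<lambda>\<omega>. p \<omega> (V \<omega>))"
    and fresh_noise_variance: "expectation (\<lambda>\<omega>. (norm (p \<omega> (V \<omega>)))\<^sup>2) \<le> expectation c"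
    and fresh_noise_uncorrelated: "\<And>b. square_integrable M b \<Longrightarrow> b \<in> borel_measurable F \<Longrightarrow>
      expectation (\<lambda>\<omega>. b \<omega> \<bullet> p \<omega> (V \<omega>)) = 0"
proof -
  have spF: "space F = space M" and seF: "sets F \<subseteq> sets M" using sub by (auto simp: subalgebra_def)
  have idF[measurable]: "(\<lambda>\<omega>. \<omega>) \<in> measurable M F"
    using spF seF sets.sets_into_space by (intro measurableI) (auto simp: Int_absorb2)
  note V[measurable] p[measurable]
  \<comment> \<open>The restriction of \<open>M\<close> to \<open>F\<close>, written as the law of
    the identity so that expectations transfer by the rules for \<open>distr\<close>.\<close>
  define F' where "F' = distr M F (\<lambda>\<omega>. \<omega>)"
  define J where "J = distr M (F \<Otimes>\<^sub>M K) (\<lambda>\<omega>. (\<omega>, V \<omega>))"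
  have sF'[measurable_cong, simp]: "sets F' = sets F" and spF'[simp]: "space F' = space M"
    by (simp_all add: F'_def spF)
  interpret F': prob_space F' unfolding F'_def by (rule prob_space_distr) simp
  interpret K: prob_space K by (subst law[symmetric]) (rule prob_space_distr[OF V])
  interpret FK: pair_prob_space F' K ..
  have J: "F' \<Otimes>\<^sub>M K = J"
  proof (rule pair_measure_eqI)
    show "sigma_finite_measure F'" "sigma_finite_measure K" by unfold_locales
    show "sets (F' \<Otimes>\<^sub>M K) = sets J" by (simp add: J_def cong: sets_pair_measure_cong)
    fix A B assume "A \<in> sets F'" "B \<in> sets K"
    then have AB: "A \<in> sets F" "B \<in> sets K" by simp_all
    then have "A \<subseteq> space M" using sets.sets_into_space spF by blast
    have "emeasure J (A \<times> B) = emeasure M ((\<lambda>\<omega>. (\<omega>, V \<omega>)) -` (A \<times> B) \<inter> space M)"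
      unfolding J_def using AB by (intro emeasure_distr) auto
    also have "(\<lambda>\<omega>. (\<omega>, V \<omega>)) -` (A \<times> B) \<inter> space M = A \<inter> (V -` B \<inter> space M)"
      using \<open>A \<subseteq> space M\<close> by auto
    also have "emeasure M \<dots> = ennreal (prob A) * ennreal (prob (V -` B \<inter> space M))"
      using AB by (simp add: emeasure_eq_measure ind ennreal_mult')
    also have "ennreal (prob A) = emeasure F' A"
      unfolding F'_def using AB \<open>A \<subseteq> space M\<close> by (subst emeasure_distr) (simp_all add: emeasure_eq_measure Int_absorb2)
    also have "ennreal (prob (V -` B \<inter> space M)) = emeasure K B"
      using AB emeasure_distr[OF V, of B] by (simp add: law emeasure_eq_measure)
    finally show "emeasure F' A * emeasure K B = emeasure J (A \<times> B)" by simp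
  qed
  have int_iff: "integrable M (\<lambda>\<omega>. \<phi> (\<omega>, V \<omega>)) \<longleftrightarrow> integrable J \<phi>"
    and int_eq: "expectation (\<lambda>\<omega>. \<phi> (\<omega>, V \<omega>)) = integral\<^sup>L J \<phi>"
    if [measurable]: "\<phi> \<in> borel_measurable (F \<Otimes>\<^sub>M K)" for \<phi> :: "'a \<times> 'k \<Rightarrow> real"
    unfolding J_def by (simp_all add: integrable_distr_eq integral_distr)
  have cF': "integrable F' c" "integral\<^sup>L F' c = expectation c"
    unfolding F'_def using c by (simp_all add: integrable_distr_eq integral_distr)
  have p_meas: "(\<lambda>\<omega>. p \<omega> (V \<omega>)) \<in> borel_measurable M" by measurable
  let ?\<phi> = "\<lambda>z. (norm (case_prod p z))\<^sup>2"
  \<comment> \<open>Integrability on the product is a result here: the conditional second moments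
    are dominated by the integrable \<open>c\<close>, and the Fubini criterion lifts this to the
    joint law.\<close>
  have inner_int: "integrable F' (\<lambda>\<omega>. \<integral>v. (norm (p \<omega> v))\<^sup>2 \<partial>K)"
  proof (rule Bochner_Integration.integrable_bound[OF cF'(1)])
    show "(\<lambda>\<omega>. \<integral>v. (norm (p \<omega> v))\<^sup>2 \<partial>K) \<in> borel_measurable F'" by measurable
    show "AE \<omega> in F'. norm (\<integral>v. (norm (p \<omega> v))\<^sup>2 \<partial>K) \<le> norm (c \<omega>)"
      using pc by (intro AE_I2) (fastforce intro: order_trans[OF _ abs_ge_self])
  qed
  have J_int: "integrable (F' \<Otimes>\<^sub>M K) ?\<phi>"
  proof (rule FK.Fubini_integrable)
    show "?\<phi> \<in> borel_measurable (F' \<Otimes>\<^sub>M K)" by measurable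
    show "integrable F' (\<lambda>\<omega>. \<integral>v. norm (?\<phi> (\<omega>, v)) \<partial>K)" using inner_int by simp
    show "AE \<omega> in F'. integrable K (\<lambda>v. ?\<phi> (\<omega>, v))" using p2 by (intro AE_I2) simp
  qed
  show sq: "square_integrable M (\<lambda>\<omega>. p \<omega> (V \<omega>))"
    using p_meas J_int int_iff[of ?\<phi>] by (simp add: square_integrable_def J)
  have "expectation (\<lambda>\<omega>. (norm (p \<omega> (V \<omega>)))\<^sup>2) = integral\<^sup>L (F' \<Otimes>\<^sub>M K) ?\<phi>"
    using int_eq[of ?\<phi>] by (simp add: J)
  also have "\<dots> = (\<integral>\<omega>. \<integral>v. (norm (p \<omega> v))\<^sup>2 \<partial>K \<partial>F')"
    using FK.integral_fst'[OF J_int] by simp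
  also have "\<dots> \<le> integral\<^sup>L F' c"
    by (rule integral_mono[OF inner_int cF'(1)]) (simp add: pc)
  finally show "expectation (\<lambda>\<omega>. (norm (p \<omega> (V \<omega>)))\<^sup>2) \<le> expectation c" by (simp add: cF')
  fix b :: "'a \<Rightarrow> 'v" assume b: "square_integrable M b" and [measurable]: "b \<in> borel_measurable F"
  let ?\<psi> = "\<lambda>z. b (fst z) \<bullet> case_prod p z"
  have "integrable (F' \<Otimes>\<^sub>M K) ?\<psi>"
    using square_integrable_inner[OF b sq] int_iff[of ?\<psi>] by (simp add: J)
  from FK.integral_fst'[OF this]
  have "expectation (\<lambda>\<omega>. b \<omega> \<bullet> p \<omega> (V \<omega>)) = (\<integral>\<omega>. \<integral>v. b \<omega> \<bullet> p \<omega> v \<partial>K \<partial>F')"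
    using int_eq[of ?\<psi>] by (simp add: J)
  also have "\<dots> = (\<integral>\<omega>. 0 \<partial>F')"
    by (rule Bochner_Integration.integral_cong) (simp_all add: p1 p0)
  finally show "expectation (\<lambda>\<omega>. b \<omega> \<bullet> p \<omega> (V \<omega>)) = 0" by simp
qed

text \<open>Grouping the indices into the blocks \<open>T\<close> and \<open>{i}\<close>, labelled
  by \<open>bool\<close>: independence passes from the generators to the generated sigma-algebras
  because the generators are closed under intersection.\<close>

lemma (in prob_space) indep_sets_sigma_split:
  assumes ind: "indep_sets \<A> UNIV" and stable: "\<And>i. Int_stable (\<A> i)" and "i \<notin> T"
    and a: "a \<in> sigma_sets (space M) (\<Union>j\<in>T. \<A> j)" and b: "b \<in> \<A> i"
  shows "prob (a \<inter> b) = prob a * prob b"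
proof -
  let ?I = "case_bool T {i}"
  have "indep_sets (\<lambda>j. sigma_sets (space M) (\<Union>i\<in>?I j. \<A> i)) UNIV"
  proof (rule indep_sets_collect_sigma)
    show "indep_sets \<A> (\<Union>j\<in>UNIV. ?I j)" by (rule indep_sets_mono_index[OF _ ind]) auto
    show "disjoint_family_on ?I UNIV"
      using \<open>i \<notin> T\<close> by (auto simp: disjoint_family_on_def split: bool.splits)
  qed (rule stable)
  from indep_setsD[OF this, of UNIV "case_bool a b"]
  show ?thesis using a b by (simp add: UNIV_bool Int_commute mult.commute sigma_sets.Basic)
qed

section \<open>The LEAD process\<close>

text \<open>The only regularity of the objective at this level is the Lipschitz bound, which carries
  second moments through the gradients; strong monotonicity and the minimizer come with
  \<open>lead_analysis\<close>.\<close>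

locale lead_process = prob_space M for M :: "'a measure" +
  fixes W :: "real^'n^'n"
    and g :: "'n \<Rightarrow> real^'d \<Rightarrow> 's \<Rightarrow> real^'d" and gradf :: "'n \<Rightarrow> real^'d \<Rightarrow> real^'d"
    and S :: "'n \<Rightarrow> 's measure" and R :: "'t measure" and q :: "real^'d \<Rightarrow> 't \<Rightarrow> real^'d"
    and \<xi> :: "nat \<Rightarrow> 'a \<Rightarrow> 'n \<Rightarrow> 's" and \<zeta> :: "nat \<Rightarrow> 'a \<Rightarrow> 'n \<Rightarrow> 't"
    and \<sigma> :: "'n \<Rightarrow> real" and C L :: real and \<eta> \<gamma> \<alpha> :: "nat \<Rightarrow> real"
    and X0 H1 Z :: "real^'d^'n" and X H D :: "nat \<Rightarrow> 'a \<Rightarrow> real^'d^'n"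
  assumes unbiased: "unbiased_contracted C R q"
    and stochastic: "\<And>i. stochastic_gradient (\<sigma> i) (S i) (g i) (gradf i)"
    and fresh: "fresh_randomness M S R \<xi> \<zeta>"
    and lipschitz: "\<And>i x y. (norm (gradf i x - gradf i y))\<^sup>2 \<le> L\<^sup>2 * (norm (x - y))\<^sup>2"
    and path: "\<And>\<omega>. \<omega> \<in> space M \<Longrightarrow>
      lead_path W g q \<eta> \<gamma> \<alpha> X0 H1 Z (\<lambda>k. \<xi> k \<omega>) (\<lambda>k. \<zeta> k \<omega>)
        (\<lambda>k. X k \<omega>) (\<lambda>k. H k \<omega>) (\<lambda>k. D k \<omega>)"
begin

text \<open>The events decided by one noise vector, \<open>Inl k\<close> for the samples and
  \<open>Inr k\<close> for the seeds of iteration \<open>k\<close>. Whole vectors form the unit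
  because the agents may be dependent within an iteration.\<close>

definition noise_events :: "nat + nat \<Rightarrow> 'a set set" where
  "noise_events = case_sum (\<lambda>k. sets (vimage_algebra (space M) (\<xi> k) (PiM UNIV S)))
                           (\<lambda>k. sets (vimage_algebra (space M) (\<zeta> k) (PiM UNIV (\<lambda>_. R))))"

definition past :: "(nat + nat) set \<Rightarrow> 'a measure" where
  "past T = sigma (space M) (\<Union>i\<in>T. noise_events i)"

abbreviation before_gradient :: "nat \<Rightarrow> 'a measure" where
  "before_gradient k \<equiv> past (Inl ` {..<k} \<union> Inr ` {..<k})"

text \<open>The closed bound on the samples is the difference from \<open>before_gradient\<close>:
  \<open>Y k\<close> uses sample \<open>k\<close>, while seed \<open>k\<close> is still to be
  drawn.\<close>

abbreviation before_compression :: "nat \<Rightarrow> 'a measure" where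
  "before_compression k \<equiv> past (Inl ` {..k} \<union> Inr ` {..<k})"

definition grad :: "real^'d^'n \<Rightarrow> real^'d^'n" where
  "grad V = (\<chi> i. gradf i (V $ i))"

definition G :: "nat \<Rightarrow> 'a \<Rightarrow> real^'d^'n" where
  "G k \<omega> = stoch_grad_matrix g (X k \<omega>) (\<xi> k \<omega>)"

definition grad_noise :: "nat \<Rightarrow> 'a \<Rightarrow> real^'d^'n" where
  "grad_noise k \<omega> = G k \<omega> - grad (X k \<omega>)"

definition Y :: "nat \<Rightarrow> 'a \<Rightarrow> real^'d^'n" where
  "Y k \<omega> = X k \<omega> - \<eta> k *\<^sub>R G k \<omega> - \<eta> k *\<^sub>R D k \<omega>"

text \<open>Signed so that \<open>Yhat = Y + comp_noise\<close>, which eliminates \<open>Q\<close>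
  and \<open>Yhat\<close> from the updates.\<close>

definition comp_noise :: "nat \<Rightarrow> 'a \<Rightarrow> real^'d^'n" where
  "comp_noise k \<omega> = compress q (Y k \<omega> - H k \<omega>) (\<zeta> k \<omega>) - (Y k \<omega> - H k \<omega>)"

lemma path_init:
  assumes "\<omega> \<in> space M"
  shows "X 0 \<omega> = X0" "H (Suc 0) \<omega> = H1" "D (Suc 0) \<omega> = (mat 1 - W) ** Z"
    "X (Suc 0) \<omega> = X0 - \<eta> 0 *\<^sub>R G 0 \<omega>"
  using path[OF assms] by (simp_all add: lead_path_def G_def)

lemma path_step:
  assumes "\<omega> \<in> space M" "1 \<le> k"
  shows "H (Suc k) \<omega> = (1 - \<alpha> k) *\<^sub>R H k \<omega> + \<alpha> k *\<^sub>R (Y k \<omega> + comp_noise k \<omega>)"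
    "D (Suc k) \<omega> = D k \<omega> + (\<gamma> k / (2 * \<eta> k)) *\<^sub>R ((mat 1 - W) ** (Y k \<omega> + comp_noise k \<omega>))"
    "X (Suc k) \<omega> = X k \<omega> - \<eta> k *\<^sub>R G k \<omega> - \<eta> k *\<^sub>R D (Suc k) \<omega>"
proof -
  have "H k \<omega> + compress q (Y k \<omega> - H k \<omega>) (\<zeta> k \<omega>) = Y k \<omega> + comp_noise k \<omega>"
    by (simp add: comp_noise_def)
  moreover have "H (Suc k) \<omega> = (1 - \<alpha> k) *\<^sub>R H k \<omega> +
        \<alpha> k *\<^sub>R (H k \<omega> + compress q (Y k \<omega> - H k \<omega>) (\<zeta> k \<omega>)) \<and>
      D (Suc k) \<omega> = D k \<omega> + (\<gamma> k / (2 * \<eta> k)) *\<^sub>R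
        ((mat 1 - W) ** (H k \<omega> + compress q (Y k \<omega> - H k \<omega>) (\<zeta> k \<omega>))) \<and>
      X (Suc k) \<omega> = X k \<omega> - \<eta> k *\<^sub>R G k \<omega> - \<eta> k *\<^sub>R D (Suc k) \<omega>"
    using path[OF assms(1)] assms(2) unfolding lead_path_def Let_def G_def Y_def by blast
  ultimately show "H (Suc k) \<omega> = (1 - \<alpha> k) *\<^sub>R H k \<omega> + \<alpha> k *\<^sub>R (Y k \<omega> + comp_noise k \<omega>)"
    "D (Suc k) \<omega> = D k \<omega> + (\<gamma> k / (2 * \<eta> k)) *\<^sub>R ((mat 1 - W) ** (Y k \<omega> + comp_noise k \<omega>))"
    "X (Suc k) \<omega> = X k \<omega> - \<eta> k *\<^sub>R G k \<omega> - \<eta> k *\<^sub>R D (Suc k) \<omega>"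
    by simp_all
qed

section \<open>The noise filtration and its independence from fresh noise\<close>

lemma noise_indep: "indep_sets noise_events UNIV"
  using fresh unfolding fresh_randomness_def noise_events_def by blast

lemma noise_events_subset: "noise_events i \<subseteq> events"
  using noise_indep by (auto simp: indep_sets_def)

lemma space_past [simp]: "space (past T) = space M"
  by (simp add: past_def space_measure_of_conv)

lemma sets_past: "sets (past T) = sigma_sets (space M) (\<Union>i\<in>T. noise_events i)"
  unfolding past_def using noise_events_subset sets.sets_into_space
  by (intro sets_measure_of) blast

lemma subalgebra_past: "subalgebra M (past T)"
  unfolding subalgebra_def sets_past using noise_events_subset
  by (auto intro!: sets.sigma_sets_subset)

lemma subalgebra_past_mono: "T \<subseteq> T' \<Longrightarrow> subalgebra (past T') (past T)"
  unfolding subalgebra_def sets_past by (auto intro!: sigma_sets_mono')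

lemma measurable_past_mono: "T \<subseteq> T' \<Longrightarrow> u \<in> measurable (past T) N \<Longrightarrow> u \<in> measurable (past T') N"
  by (rule measurable_from_subalg[OF subalgebra_past_mono])

lemma past_indep:
  assumes "i \<notin> T" "a \<in> sets (past T)" "b \<in> noise_events i"
  shows "prob (a \<inter> b) = prob a * prob b"
proof (rule indep_sets_sigma_split[OF noise_indep _ assms(1) _ assms(3)])
  show "Int_stable (noise_events i)" for i
    by (cases i) (auto simp: noise_events_def Int_stable_def)
qed (use assms(2) in \<open>simp add: sets_past\<close>)

lemma sample_measurable: "(\<lambda>\<omega>. \<xi> k \<omega> i) \<in> measurable M (S i)" "distr M (S i) (\<lambda>\<omega>. \<xi> k \<omega> i) = S i"
  and seed_measurable: "(\<lambda>\<omega>. \<zeta> k \<omega> i) \<in> measurable M R" "distr M R (\<lambda>\<omega>. \<zeta> k \<omega> i) = R"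
  using fresh unfolding fresh_randomness_def by blast+

text \<open>\<open>noise_events\<close> speaks of the vector over all agents, so an event of one
  agent is pulled back through the coordinate projection.\<close>

lemma sample_event:
  assumes "b \<in> sets (S i)"
  shows "(\<lambda>\<omega>. \<xi> k \<omega> i) -` b \<inter> space M \<in> noise_events (Inl k)"
proof -
  have "(\<lambda>f. f i) -` b \<inter> space (PiM UNIV S) \<in> sets (PiM UNIV S)"
    using assms by (intro measurable_sets[OF measurable_component_singleton]) auto
  from in_vimage_algebra[OF this, of "\<xi> k" "space M"]
  have "\<xi> k -` ((\<lambda>f. f i) -` b \<inter> space (PiM UNIV S)) \<inter> space M \<in> noise_events (Inl k)"
    by (simp add: noise_events_def)
  also have "\<xi> k -` ((\<lambda>f. f i) -` b \<inter> space (PiM UNIV S)) \<inter> space M = (\<lambda>\<omega>. \<xi> k \<omega> i) -` b \<inter> space M"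
    using measurable_space[OF sample_measurable(1)] by (auto simp: space_PiM PiE_def)
  finally show ?thesis .
qed

lemma seed_event:
  assumes "b \<in> sets R"
  shows "(\<lambda>\<omega>. \<zeta> k \<omega> i) -` b \<inter> space M \<in> noise_events (Inr k)"
proof -
  have "(\<lambda>f. f i) -` b \<inter> space (PiM UNIV (\<lambda>_. R)) \<in> sets (PiM UNIV (\<lambda>_. R))"
    using assms by (intro measurable_sets[OF measurable_component_singleton]) auto
  from in_vimage_algebra[OF this, of "\<zeta> k" "space M"]
  have "\<zeta> k -` ((\<lambda>f. f i) -` b \<inter> space (PiM UNIV (\<lambda>_. R))) \<inter> space M \<in> noise_events (Inr k)"
    by (simp add: noise_events_def)
  also have "\<zeta> k -` ((\<lambda>f. f i) -` b \<inter> space (PiM UNIV (\<lambda>_. R))) \<inter> space M = (\<lambda>\<omega>. \<zeta> k \<omega> i) -` b \<inter> space M"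
    using measurable_space[OF seed_measurable(1)] by (auto simp: space_PiM PiE_def)
  finally show ?thesis .
qed

lemma noise_event_past: "b \<in> noise_events i \<Longrightarrow> i \<in> T \<Longrightarrow> b \<in> sets (past T)"
  unfolding sets_past by (auto intro: sigma_sets.Basic)

lemma sample_measurable_past: "Inl k \<in> T \<Longrightarrow> (\<lambda>\<omega>. \<xi> k \<omega> i) \<in> measurable (past T) (S i)"
  using measurable_space[OF sample_measurable(1)] noise_event_past[OF sample_event]
  by (intro measurableI) auto

lemma seed_measurable_past: "Inr k \<in> T \<Longrightarrow> (\<lambda>\<omega>. \<zeta> k \<omega> i) \<in> measurable (past T) R"
  using measurable_space[OF seed_measurable(1)] noise_event_past[OF seed_event]
  by (intro measurableI) auto

section \<open>Measurability of the iterates with respect to the past\<close>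

lemma G_measurable:
  assumes "X k \<in> borel_measurable (past T)" "Inl k \<in> T"
  shows "G k \<in> borel_measurable (past T)"
proof (rule borel_measurable_vec_components)
  fix i
  have "case_prod (g i) \<in> borel_measurable (borel \<Otimes>\<^sub>M S i)"
    using stochastic by (simp add: stochastic_gradient_def)
  from measurable_compose[OF measurable_Pair[OF borel_measurable_vec_component[OF assms(1)]
      sample_measurable_past[OF assms(2)]] this]
  show "(\<lambda>\<omega>. G k \<omega> $ i) \<in> borel_measurable (past T)"
    by (simp add: G_def stoch_grad_matrix_def)
qed

lemma comp_noise_measurable:
  assumes "Y k \<in> borel_measurable (past T)" "H k \<in> borel_measurable (past T)" "Inr k \<in> T"
  shows "comp_noise k \<in> borel_measurable (past T)"
proof (rule borel_measurable_vec_components)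
  fix i
  have "case_prod q \<in> borel_measurable (borel \<Otimes>\<^sub>M R)"
    using unbiased by (simp add: unbiased_contracted_def)
  moreover have a: "(\<lambda>\<omega>. (Y k \<omega> - H k \<omega>) $ i) \<in> borel_measurable (past T)"
    by (intro borel_measurable_vec_component borel_measurable_diff assms)
  ultimately have "(\<lambda>\<omega>. q ((Y k \<omega> - H k \<omega>) $ i) (\<zeta> k \<omega> i)) \<in> borel_measurable (past T)"
    using measurable_compose[OF measurable_Pair[OF a seed_measurable_past[OF assms(3), of i]], of "case_prod q"]
    by simp
  from borel_measurable_diff[OF this a]
  show "(\<lambda>\<omega>. comp_noise k \<omega> $ i) \<in> borel_measurable (past T)"
    by (simp add: comp_noise_def compress_def)
qed

text \<open>The exact gradient is a parametrized integral of the jointly measurable stochastic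
  gradient.\<close>

lemma gradf_measurable: "gradf i \<in> borel_measurable borel"
proof -
  have s: "prob_space (S i)" and [measurable]: "case_prod (g i) \<in> borel_measurable (borel \<Otimes>\<^sub>M S i)"
    and eq: "\<And>x. (\<integral>s. g i x s \<partial>S i) = gradf i x"
    using stochastic[of i] by (auto simp: stochastic_gradient_def)
  interpret S: prob_space "S i" by (rule s)
  have "(\<lambda>x. \<integral>s. g i x s \<partial>S i) \<in> borel_measurable borel" by measurable
  then show ?thesis by (simp add: eq)
qed

lemma grad_measurable: "u \<in> borel_measurable N \<Longrightarrow> (\<lambda>\<omega>. grad (u \<omega>)) \<in> borel_measurable N"
  by (rule borel_measurable_vec_components)
     (simp add: grad_def measurable_compose[OF borel_measurable_vec_component gradf_measurable])

lemma Y_measurable: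
  assumes "X k \<in> borel_measurable (past T)" "D k \<in> borel_measurable (past T)" "Inl k \<in> T"
  shows "Y k \<in> borel_measurable (past T)"
  unfolding Y_def
  by (intro borel_measurable_diff borel_measurable_scaleR assms G_measurable borel_measurable_const)

lemma matrix_mult_measurable:
  fixes A :: "real^'n^'n" and u :: "'b \<Rightarrow> real^'d^'n"
  shows "u \<in> borel_measurable N \<Longrightarrow> (\<lambda>\<omega>. A ** u \<omega>) \<in> borel_measurable N"
  by (rule borel_measurable_continuous_on[OF linear_continuous_on[OF bounded_linear_matrix_mult]])

text \<open>The three sequences need a joint induction because their updates are coupled. The
  passage from \<open>0\<close> to \<open>1\<close> is separate: it involves no compression, and
  \<open>H 0\<close> and \<open>D 0\<close> are unspecified.\<close>

lemma state_measurable: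
  "X k \<in> borel_measurable (before_gradient k)"
  "1 \<le> k \<Longrightarrow> H k \<in> borel_measurable (before_gradient k)"
  "1 \<le> k \<Longrightarrow> D k \<in> borel_measurable (before_gradient k)"
proof (induction k)
  case 0
  \<comment> \<open>The recursion is known only on \<open>space M\<close>, so the iterates are
    replaced by congruence there and not as functions.\<close>
  have "X 0 \<in> borel_measurable (past T) \<longleftrightarrow> (\<lambda>_. X0) \<in> borel_measurable (past T)" for T
    by (rule measurable_cong) (simp add: path_init)
  then show "X 0 \<in> borel_measurable (before_gradient 0)" by simp
next
  case (Suc k)
  let ?P = "before_gradient (Suc k)"
  have mono: "u \<in> borel_measurable ?P" if "u \<in> borel_measurable (before_gradient k)" for u :: "'a \<Rightarrow> real^'d^'n"
    using that by (rule measurable_past_mono[rotated]) auto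
  have X: "X k \<in> borel_measurable ?P" by (rule mono[OF Suc.IH(1)])
  have G: "G k \<in> borel_measurable ?P" by (rule G_measurable[OF X]) auto
  show "X (Suc k) \<in> borel_measurable ?P" "H (Suc k) \<in> borel_measurable ?P" "D (Suc k) \<in> borel_measurable ?P"
  proof (atomize (full), cases "k = 0")
    case True
    have "H (Suc 0) \<in> borel_measurable ?P \<longleftrightarrow> (\<lambda>_. H1) \<in> borel_measurable ?P"
      "D (Suc 0) \<in> borel_measurable ?P \<longleftrightarrow> (\<lambda>_. (mat 1 - W) ** Z) \<in> borel_measurable ?P"
      "X (Suc 0) \<in> borel_measurable ?P \<longleftrightarrow> (\<lambda>\<omega>. X0 - \<eta> 0 *\<^sub>R G 0 \<omega>) \<in> borel_measurable ?P"
      by (rule measurable_cong, simp add: path_init)+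
    moreover have "(\<lambda>\<omega>. X0 - \<eta> 0 *\<^sub>R G 0 \<omega>) \<in> borel_measurable ?P"
      using G True by (intro borel_measurable_diff borel_measurable_scaleR) auto
    ultimately show "X (Suc k) \<in> borel_measurable ?P \<and> H (Suc k) \<in> borel_measurable ?P \<and>
        D (Suc k) \<in> borel_measurable ?P"
      using True by simp
  next
    case False
    then have k: "1 \<le> k" by simp
    have H: "H k \<in> borel_measurable ?P" and D: "D k \<in> borel_measurable ?P"
      by (rule mono[OF Suc.IH(2)[OF k]], rule mono[OF Suc.IH(3)[OF k]])
    have Y: "Y k \<in> borel_measurable ?P" by (rule Y_measurable[OF X D]) auto
    have e: "comp_noise k \<in> borel_measurable ?P" by (rule comp_noise_measurable[OF Y H]) auto
    have "H (Suc k) \<in> borel_measurable ?P \<longleftrightarrow>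
        (\<lambda>\<omega>. (1 - \<alpha> k) *\<^sub>R H k \<omega> + \<alpha> k *\<^sub>R (Y k \<omega> + comp_noise k \<omega>)) \<in> borel_measurable ?P"
      by (rule measurable_cong) (simp add: path_step(1)[OF _ k])
    also have "\<dots>"
      by (intro borel_measurable_add borel_measurable_scaleR borel_measurable_const H Y e)
    finally have H': "H (Suc k) \<in> borel_measurable ?P" .
    have "D (Suc k) \<in> borel_measurable ?P \<longleftrightarrow>
        (\<lambda>\<omega>. D k \<omega> + (\<gamma> k / (2 * \<eta> k)) *\<^sub>R ((mat 1 - W) ** (Y k \<omega> + comp_noise k \<omega>))) \<in> borel_measurable ?P"
      by (rule measurable_cong) (simp add: path_step(2)[OF _ k])
    also have "\<dots>"
      by (intro borel_measurable_add borel_measurable_scaleR borel_measurable_const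
          matrix_mult_measurable D Y e)
    finally have D': "D (Suc k) \<in> borel_measurable ?P" .
    have "X (Suc k) \<in> borel_measurable ?P \<longleftrightarrow>
        (\<lambda>\<omega>. X k \<omega> - \<eta> k *\<^sub>R G k \<omega> - \<eta> k *\<^sub>R D (Suc k) \<omega>) \<in> borel_measurable ?P"
      by (rule measurable_cong) (simp add: path_step(3)[OF _ k])
    also have "\<dots>"
      by (intro borel_measurable_diff borel_measurable_scaleR borel_measurable_const X G D')
    finally show "X (Suc k) \<in> borel_measurable ?P \<and> H (Suc k) \<in> borel_measurable ?P \<and>
        D (Suc k) \<in> borel_measurable ?P"
      using H' D' by simp
  qed
qed simp_all

section \<open>Moments of the sampling noise and of the compression noise\<close>

lemma
  shows grad_noise_square_integrable: "square_integrable M (grad_noise k)"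
    and grad_noise_variance: "expectation (\<lambda>\<omega>. (norm (grad_noise k \<omega>))\<^sup>2) \<le> (\<Sum>i\<in>UNIV. (\<sigma> i)\<^sup>2)"
    and grad_noise_uncorrelated: "\<And>b. square_integrable M b \<Longrightarrow> b \<in> borel_measurable (before_gradient k) \<Longrightarrow>
      expectation (\<lambda>\<omega>. b \<omega> \<bullet> grad_noise k \<omega>) = 0"
proof -
  let ?F = "before_gradient k"
  define p where "p i \<omega> s = g i (X k \<omega> $ i) s - gradf i (X k \<omega> $ i)" for i \<omega> s
  have gi: "prob_space (S i)" "case_prod (g i) \<in> borel_measurable (borel \<Otimes>\<^sub>M S i)"
    "integrable (S i) (g i x)" "(\<integral>s. g i x s \<partial>S i) = gradf i x"
    "integrable (S i) (\<lambda>s. (norm (g i x s - gradf i x))\<^sup>2)"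
    "(\<integral>s. (norm (g i x s - gradf i x))\<^sup>2 \<partial>S i) \<le> (\<sigma> i)\<^sup>2" for i x
    using stochastic[of i] by (auto simp: stochastic_gradient_def)
  have Xi: "(\<lambda>\<omega>. X k \<omega> $ i) \<in> borel_measurable ?F" for i
    by (rule borel_measurable_vec_component[OF state_measurable(1)])
  have "case_prod (p i) \<in> borel_measurable (?F \<Otimes>\<^sub>M S i)" for i
  proof -
    note [measurable] = Xi gi(2) gradf_measurable
    show ?thesis unfolding p_def by measurable
  qed
  note pm = this
  have ind: "prob (a \<inter> ((\<lambda>\<omega>. \<xi> k \<omega> i) -` b \<inter> space M)) = prob a * prob ((\<lambda>\<omega>. \<xi> k \<omega> i) -` b \<inter> space M)"
    if "a \<in> sets ?F" "b \<in> sets (S i)" for a b i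
    using that by (intro past_indep[OF _ _ sample_event]) auto
  have p1: "integrable (S i) (p i \<omega>)" and p0: "(\<integral>s. p i \<omega> s \<partial>S i) = 0" if "\<omega> \<in> space M" for i \<omega>
  proof -
    interpret K: prob_space "S i" by (rule gi(1))
    show "integrable (S i) (p i \<omega>)"
      unfolding p_def by (intro Bochner_Integration.integrable_diff gi(3) K.integrable_const)
    show "(\<integral>s. p i \<omega> s \<partial>S i) = 0"
      unfolding p_def using gi(3,4) by (subst Bochner_Integration.integral_diff) (simp_all add: K.prob_space)
  qed
  have p2: "integrable (S i) (\<lambda>s. (norm (p i \<omega> s))\<^sup>2)" "(\<integral>s. (norm (p i \<omega> s))\<^sup>2 \<partial>S i) \<le> (\<sigma> i)\<^sup>2"
    if "\<omega> \<in> space M" for i \<omega>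
    using gi by (simp_all add: p_def)
  have c: "integrable M (\<lambda>_. (\<sigma> i)\<^sup>2)" "(\<lambda>_. (\<sigma> i)\<^sup>2) \<in> borel_measurable ?F" for i by auto
  have noise: "grad_noise k \<omega> $ i = p i \<omega> (\<xi> k \<omega> i)" for \<omega> i
    by (simp add: grad_noise_def G_def grad_def stoch_grad_matrix_def p_def)
  have sq: "square_integrable M (\<lambda>\<omega>. grad_noise k \<omega> $ i)"
    and var: "expectation (\<lambda>\<omega>. (norm (grad_noise k \<omega> $ i))\<^sup>2) \<le> expectation (\<lambda>\<omega>. (\<sigma> i)\<^sup>2)" for i
    unfolding noise
    by (rule fresh_noise_square_integrable[where V = "\<lambda>\<omega>. \<xi> k \<omega> i" and p = "p i" and F = ?F and K = "S i" and c = "\<lambda>_. (\<sigma> i)\<^sup>2"],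
        (rule subalgebra_past sample_measurable | fact)+,
        rule fresh_noise_variance[where V = "\<lambda>\<omega>. \<xi> k \<omega> i" and p = "p i" and F = ?F and K = "S i" and c = "\<lambda>_. (\<sigma> i)\<^sup>2"],
        (rule subalgebra_past sample_measurable | fact)+)
  have unc: "expectation (\<lambda>\<omega>. b \<omega> \<bullet> grad_noise k \<omega> $ i) = 0"
    if "square_integrable M b" "b \<in> borel_measurable ?F" for b i
    unfolding noise
    by (rule fresh_noise_uncorrelated[where V = "\<lambda>\<omega>. \<xi> k \<omega> i" and p = "p i" and F = ?F and K = "S i" and c = "\<lambda>_. (\<sigma> i)\<^sup>2"],
        (rule subalgebra_past sample_measurable | fact)+)
  show sqn: "square_integrable M (grad_noise k)" by (rule square_integrable_components[OF sq])
  have int: "integrable M (\<lambda>\<omega>. (norm (grad_noise k \<omega> $ i))\<^sup>2)" for i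
    using sq by (simp add: square_integrable_def)
  \<comment> \<open>Squared norms add up over the agents without cross terms, so dependence between
    the samples of one iteration does no harm.\<close>
  have "expectation (\<lambda>\<omega>. (norm (grad_noise k \<omega>))\<^sup>2) = (\<Sum>i\<in>UNIV. expectation (\<lambda>\<omega>. (norm (grad_noise k \<omega> $ i))\<^sup>2))"
    unfolding norm_vec_square[of "_ :: real^'d^'n"] using int by (rule Bochner_Integration.integral_sum)
  also have "\<dots> \<le> (\<Sum>i\<in>UNIV. (\<sigma> i)\<^sup>2)"
    using var by (intro sum_mono) (simp add: prob_space)
  finally show "expectation (\<lambda>\<omega>. (norm (grad_noise k \<omega>))\<^sup>2) \<le> (\<Sum>i\<in>UNIV. (\<sigma> i)\<^sup>2)" .
  fix b :: "'a \<Rightarrow> real^'d^'n" assume b: "square_integrable M b" "b \<in> borel_measurable ?F"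
  have "expectation (\<lambda>\<omega>. b \<omega> \<bullet> grad_noise k \<omega>) = (\<Sum>i\<in>UNIV. expectation (\<lambda>\<omega>. b \<omega> $ i \<bullet> grad_noise k \<omega> $ i))"
    unfolding inner_vec_def[of "_ :: real^'d^'n"]
    by (rule Bochner_Integration.integral_sum)
       (intro square_integrable_inner square_integrable_component[OF b(1)] sq)
  also have "\<dots> = 0"
    by (intro sum.neutral ballI unc square_integrable_component[OF b(1)] borel_measurable_vec_component[OF b(2)])
  finally show "expectation (\<lambda>\<omega>. b \<omega> \<bullet> grad_noise k \<omega>) = 0" .
qed

text \<open>Unlike the sampling variance, this bound is random, namely \<open>C\<close> times the
  squared norm of the compressed row. The integrability of \<open>Y - H\<close> must therefore be
  known beforehand, and it is supplied within the induction over \<open>k\<close>.\<close>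

lemma
  assumes k: "1 \<le> k" and sqYH: "square_integrable M (\<lambda>\<omega>. Y k \<omega> - H k \<omega>)"
  shows comp_noise_square_integrable: "square_integrable M (comp_noise k)"
    and comp_noise_variance: "expectation (\<lambda>\<omega>. (norm (comp_noise k \<omega>))\<^sup>2) \<le>
      C * expectation (\<lambda>\<omega>. (norm (Y k \<omega> - H k \<omega>))\<^sup>2)"
    and comp_noise_uncorrelated: "\<And>b. square_integrable M b \<Longrightarrow> b \<in> borel_measurable (before_compression k) \<Longrightarrow>
      expectation (\<lambda>\<omega>. b \<omega> \<bullet> comp_noise k \<omega>) = 0"
proof -
  let ?F = "before_compression k"
  define a where "a i \<omega> = (Y k \<omega> - H k \<omega>) $ i" for i \<omega>
  define p where "p i \<omega> t = q (a i \<omega>) t - a i \<omega>" for i \<omega> t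
  have qx: "prob_space R" "case_prod q \<in> borel_measurable (borel \<Otimes>\<^sub>M R)"
    "integrable R (q x)" "(\<integral>t. q x t \<partial>R) = x"
    "integrable R (\<lambda>t. (norm (q x t - x))\<^sup>2)" "(\<integral>t. (norm (q x t - x))\<^sup>2 \<partial>R) \<le> C * (norm x)\<^sup>2" for x
    using unbiased by (auto simp: unbiased_contracted_def norm_minus_commute)
  have mono: "u \<in> borel_measurable ?F" if "u \<in> borel_measurable (before_gradient k)" for u :: "'a \<Rightarrow> real^'d^'n"
    using that by (rule measurable_past_mono[rotated]) auto
  have XHD: "X k \<in> borel_measurable ?F" "H k \<in> borel_measurable ?F" "D k \<in> borel_measurable ?F"
    by (rule mono[OF state_measurable(1)], rule mono[OF state_measurable(2)[OF k]],
        rule mono[OF state_measurable(3)[OF k]])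
  have "Y k \<in> borel_measurable ?F" by (rule Y_measurable[OF XHD(1,3)]) auto
  then have ai: "a i \<in> borel_measurable ?F" for i
    unfolding a_def by (intro borel_measurable_vec_component borel_measurable_diff XHD)
  have "case_prod (p i) \<in> borel_measurable (?F \<Otimes>\<^sub>M R)" for i
  proof -
    note [measurable] = ai qx(2)
    show ?thesis unfolding p_def by measurable
  qed
  note pm = this
  have ind: "prob (a \<inter> ((\<lambda>\<omega>. \<zeta> k \<omega> i) -` b \<inter> space M)) = prob a * prob ((\<lambda>\<omega>. \<zeta> k \<omega> i) -` b \<inter> space M)"
    if "a \<in> sets ?F" "b \<in> sets R" for a b i
    using that by (intro past_indep[OF _ _ seed_event]) auto
  have sqa: "square_integrable M (a i)" for i
    unfolding a_def by (rule square_integrable_component[OF sqYH])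
  have c: "integrable M (\<lambda>\<omega>. C * (norm (a i \<omega>))\<^sup>2)" "(\<lambda>\<omega>. C * (norm (a i \<omega>))\<^sup>2) \<in> borel_measurable ?F" for i
    using sqa[of i] ai[of i] by (auto simp: square_integrable_def)
  have p1: "integrable R (p i \<omega>)" and p0: "(\<integral>s. p i \<omega> s \<partial>R) = 0" if "\<omega> \<in> space M" for i \<omega>
  proof -
    interpret K: prob_space "R" by (rule qx(1))
    show "integrable (R) (p i \<omega>)"
      unfolding p_def by (intro Bochner_Integration.integrable_diff qx(3) K.integrable_const)
    show "(\<integral>s. p i \<omega> s \<partial>R) = 0"
      unfolding p_def using qx(3,4) by (subst Bochner_Integration.integral_diff) (simp_all add: K.prob_space)
  qed
  have p2: "integrable R (\<lambda>s. (norm (p i \<omega> s))\<^sup>2)" "(\<integral>s. (norm (p i \<omega> s))\<^sup>2 \<partial>R) \<le> C * (norm (a i \<omega>))\<^sup>2"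
    if "\<omega> \<in> space M" for i \<omega>
    using qx by (simp_all add: p_def)
  have noise: "comp_noise k \<omega> $ i = p i \<omega> (\<zeta> k \<omega> i)" for \<omega> i
    by (simp add: comp_noise_def compress_def p_def a_def)
  have sq: "square_integrable M (\<lambda>\<omega>. comp_noise k \<omega> $ i)"
    and var: "expectation (\<lambda>\<omega>. (norm (comp_noise k \<omega> $ i))\<^sup>2) \<le> expectation (\<lambda>\<omega>. C * (norm (a i \<omega>))\<^sup>2)" for i
    unfolding noise
    by (rule fresh_noise_square_integrable[where V = "\<lambda>\<omega>. \<zeta> k \<omega> i" and p = "p i" and F = ?F and K = "R" and c = "\<lambda>\<omega>. C * (norm (a i \<omega>))\<^sup>2"],
        (rule subalgebra_past seed_measurable | fact)+,
        rule fresh_noise_variance[where V = "\<lambda>\<omega>. \<zeta> k \<omega> i" and p = "p i" and F = ?F and K = "R" and c = "\<lambda>\<omega>. C * (norm (a i \<omega>))\<^sup>2"],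
        (rule subalgebra_past seed_measurable | fact)+)
  have unc: "expectation (\<lambda>\<omega>. b \<omega> \<bullet> comp_noise k \<omega> $ i) = 0"
    if "square_integrable M b" "b \<in> borel_measurable ?F" for b i
    unfolding noise
    by (rule fresh_noise_uncorrelated[where V = "\<lambda>\<omega>. \<zeta> k \<omega> i" and p = "p i" and F = ?F and K = "R" and c = "\<lambda>\<omega>. C * (norm (a i \<omega>))\<^sup>2"],
        (rule subalgebra_past seed_measurable | fact)+)
  show sqn: "square_integrable M (comp_noise k)" by (rule square_integrable_components[OF sq])
  have int: "integrable M (\<lambda>\<omega>. (norm (comp_noise k \<omega> $ i))\<^sup>2)" "integrable M (\<lambda>\<omega>. (norm (a i \<omega>))\<^sup>2)" for i
    using sq sqa by (simp_all add: square_integrable_def)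
  have "expectation (\<lambda>\<omega>. (norm (comp_noise k \<omega>))\<^sup>2) = (\<Sum>i\<in>UNIV. expectation (\<lambda>\<omega>. (norm (comp_noise k \<omega> $ i))\<^sup>2))"
    unfolding norm_vec_square[of "_ :: real^'d^'n"] using int(1) by (rule Bochner_Integration.integral_sum)
  also have "\<dots> \<le> (\<Sum>i\<in>UNIV. C * expectation (\<lambda>\<omega>. (norm (a i \<omega>))\<^sup>2))"
    using var by (intro sum_mono) simp
  also have "\<dots> = C * expectation (\<lambda>\<omega>. \<Sum>i\<in>UNIV. (norm (a i \<omega>))\<^sup>2)"
    using int(2) by (simp add: Bochner_Integration.integral_sum sum_distrib_left)
  also have "(\<lambda>\<omega>. \<Sum>i\<in>UNIV. (norm (a i \<omega>))\<^sup>2) = (\<lambda>\<omega>. (norm (Y k \<omega> - H k \<omega>))\<^sup>2)"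
    by (simp add: norm_vec_square[of "_ :: real^'d^'n"] a_def)
  finally show "expectation (\<lambda>\<omega>. (norm (comp_noise k \<omega>))\<^sup>2) \<le> C * expectation (\<lambda>\<omega>. (norm (Y k \<omega> - H k \<omega>))\<^sup>2)" .
  fix b :: "'a \<Rightarrow> real^'d^'n" assume b: "square_integrable M b" "b \<in> borel_measurable ?F"
  have "expectation (\<lambda>\<omega>. b \<omega> \<bullet> comp_noise k \<omega>) = (\<Sum>i\<in>UNIV. expectation (\<lambda>\<omega>. b \<omega> $ i \<bullet> comp_noise k \<omega> $ i))"
    unfolding inner_vec_def[of "_ :: real^'d^'n"]
    by (rule Bochner_Integration.integral_sum)
       (intro square_integrable_inner square_integrable_component[OF b(1)] sq)
  also have "\<dots> = 0"
    by (intro sum.neutral ballI unc square_integrable_component[OF b(1)] borel_measurable_vec_component[OF b(2)])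
  finally show "expectation (\<lambda>\<omega>. b \<omega> \<bullet> comp_noise k \<omega>) = 0" .
qed

section \<open>Finite second moments of all iterates\<close>

lemma grad_square_integrable:
  assumes "square_integrable M u"
  shows "square_integrable M (\<lambda>\<omega>. grad (u \<omega>) - grad V)"
proof (rule square_integrable_norm_le)
  show "square_integrable M (\<lambda>\<omega>. u \<omega> - V)"
    by (intro square_integrable_diff assms square_integrable_const)
  show "(\<lambda>\<omega>. grad (u \<omega>) - grad V) \<in> borel_measurable M"
    using assms by (intro borel_measurable_diff grad_measurable) (auto simp: square_integrable_def)
  \<comment> \<open>The sign of \<open>L\<close> is not fixed in this locale, hence the absolute
    value.\<close>
  show "norm (grad (u \<omega>) - grad V) \<le> \<bar>L\<bar> * norm (u \<omega> - V)" for \<omega>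
  proof (rule power2_le_imp_le)
    show "(norm (grad (u \<omega>) - grad V))\<^sup>2 \<le> (\<bar>L\<bar> * norm (u \<omega> - V))\<^sup>2"
      unfolding power_mult_distrib norm_vec_square[of "_ :: real^'d^'n"] sum_distrib_left
      by (intro sum_mono) (simp add: grad_def lipschitz)
  qed simp
qed

lemma G_square_integrable: "square_integrable M (X k) \<Longrightarrow> square_integrable M (G k)"
  using square_integrable_add[OF grad_noise_square_integrable[of k]
      square_integrable_add[OF grad_square_integrable[of "X k" 0] square_integrable_const[of "grad 0"]]]
  by (simp add: grad_noise_def)

lemma Y_square_integrable:
  "square_integrable M (X k) \<Longrightarrow> square_integrable M (D k) \<Longrightarrow> square_integrable M (Y k)"
  unfolding Y_def by (intro square_integrable_diff square_integrable_scaleR G_square_integrable)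

lemma state_square_integrable:
  "square_integrable M (X k)"
  "1 \<le> k \<Longrightarrow> square_integrable M (H k)"
  "1 \<le> k \<Longrightarrow> square_integrable M (D k)"
proof (induction k)
  case 0
  show "square_integrable M (X 0)"
    using square_integrable_const[of X0] by (subst square_integrable_cong[of M _ "\<lambda>_. X0"]) (simp_all add: path_init)
next
  case (Suc k)
  note X = Suc.IH(1) and G = G_square_integrable[OF Suc.IH(1)]
  show "square_integrable M (X (Suc k))" "square_integrable M (H (Suc k))" "square_integrable M (D (Suc k))"
  proof (atomize (full), cases "k = 0")
    case True
    have "square_integrable M (H (Suc 0)) \<longleftrightarrow> square_integrable M (\<lambda>_. H1)"
      "square_integrable M (D (Suc 0)) \<longleftrightarrow> square_integrable M (\<lambda>_. (mat 1 - W) ** Z)"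
      "square_integrable M (X (Suc 0)) \<longleftrightarrow> square_integrable M (\<lambda>\<omega>. X0 - \<eta> 0 *\<^sub>R G 0 \<omega>)"
      by (rule square_integrable_cong, simp add: path_init)+
    moreover have "square_integrable M (\<lambda>\<omega>. X0 - \<eta> 0 *\<^sub>R G 0 \<omega>)"
      using G True by (intro square_integrable_diff square_integrable_scaleR square_integrable_const) simp
    ultimately show "square_integrable M (X (Suc k)) \<and> square_integrable M (H (Suc k)) \<and> square_integrable M (D (Suc k))"
      using True square_integrable_const[of H1] square_integrable_const[of "(mat 1 - W) ** Z"] by simp
  next
    case False
    then have k: "1 \<le> k" by simp
    note H = Suc.IH(2)[OF k] and D = Suc.IH(3)[OF k]
    note Y = Y_square_integrable[OF X D]
    note e = comp_noise_square_integrable[OF k square_integrable_diff[OF Y H]]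
    have "square_integrable M (H (Suc k)) \<longleftrightarrow>
        square_integrable M (\<lambda>\<omega>. (1 - \<alpha> k) *\<^sub>R H k \<omega> + \<alpha> k *\<^sub>R (Y k \<omega> + comp_noise k \<omega>))"
      by (rule square_integrable_cong) (simp add: path_step(1)[OF _ k])
    also have "\<dots>" by (intro square_integrable_add square_integrable_scaleR H Y e)
    finally have H': "square_integrable M (H (Suc k))" .
    have "square_integrable M (D (Suc k)) \<longleftrightarrow>
        square_integrable M (\<lambda>\<omega>. D k \<omega> + (\<gamma> k / (2 * \<eta> k)) *\<^sub>R ((mat 1 - W) ** (Y k \<omega> + comp_noise k \<omega>)))"
      by (rule square_integrable_cong) (simp add: path_step(2)[OF _ k])
    also have "\<dots>"
      by (intro square_integrable_add square_integrable_scaleR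
          square_integrable_bounded_linear[OF bounded_linear_matrix_mult] D Y e)
    finally have D': "square_integrable M (D (Suc k))" .
    have "square_integrable M (X (Suc k)) \<longleftrightarrow>
        square_integrable M (\<lambda>\<omega>. X k \<omega> - \<eta> k *\<^sub>R G k \<omega> - \<eta> k *\<^sub>R D (Suc k) \<omega>)"
      by (rule square_integrable_cong) (simp add: path_step(3)[OF _ k])
    also have "\<dots>" by (intro square_integrable_diff square_integrable_scaleR X G D')
    finally show "square_integrable M (X (Suc k)) \<and> square_integrable M (H (Suc k)) \<and> square_integrable M (D (Suc k))"
      using H' D' by simp
  qed
qed simp_all

end

section \<open>Expected decrease of the Lyapunov function\<close>

locale lead_analysis = lead_process M W g gradf S R q \<xi> \<zeta> \<sigma> C L \<eta> \<gamma> \<alpha> X0 H1 Z X H D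
  for M :: "'a measure" and W :: "real^'n^'n"
    and g :: "'n \<Rightarrow> real^'d \<Rightarrow> 's \<Rightarrow> real^'d" and gradf :: "'n \<Rightarrow> real^'d \<Rightarrow> real^'d"
    and S and R :: "'t measure" and q \<xi> \<zeta> \<sigma> C L \<eta> \<gamma> \<alpha> X0 H1 Z X H D +
  fixes xstar :: "real^'d" and \<mu> :: real
  assumes kernel: "averaging_kernel (mat 1 - W)"
    and \<beta>_pos: "0 < lambda_max (mat 1 - W)"
    and C_nonneg: "0 \<le> C" and \<mu>_pos: "0 < \<mu>"
    and monotone: "\<And>i x y. \<mu> * (norm (x - y))\<^sup>2 \<le> (gradf i x - gradf i y) \<bullet> (x - y)"
    and stationary: "(\<Sum>i\<in>UNIV. gradf i xstar) = 0"
begin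

interpretation A: averaging_kernel "mat 1 - W" by (rule kernel)

abbreviation A :: "real^'n^'n" where "A \<equiv> mat 1 - W"
abbreviation P :: "real^'n^'n" where "P \<equiv> pseudoinverse A"
abbreviation \<beta> :: real where "\<beta> \<equiv> lambda_max A"
abbreviation \<kappa> :: real where "\<kappa> \<equiv> lambda_max P"

definition Xstar :: "real^'d^'n" where "Xstar = (\<chi> i. xstar)"

lemma \<kappa>_pos: "0 < \<kappa>"
  by (rule A.lambda_max_pseudoinverse_pos[OF \<beta>_pos])

interpretation pair: laplacian_pair "\<lambda>V :: real^'d^'n. A ** V" "\<lambda>V :: real^'d^'n. P ** V" \<beta> \<kappa>
proof (rule laplacian_pair.intro)
  show "linear (\<lambda>V :: real^'d^'n. A ** V)" "linear (\<lambda>V :: real^'d^'n. P ** V)"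
    by (rule bounded_linear.linear[OF bounded_linear_matrix_mult])+
qed (simp_all add: matrix_mult_inner_sym A.sym A.transpose_pseudoinverse matrix_mult_inner_nonneg A.psd
    A.pseudoinverse_psd matrix_mult_inner_le_lambda_max \<beta>_pos \<kappa>_pos)

lemma A_Xstar: "A ** Xstar = 0"
proof -
  have "averaging ** Xstar = Xstar"
    by (subst vec_eq_iff) (simp add: averaging_mult_nth Xstar_def sum_constant_scaleR del: sum_constant)
  then have "A ** Xstar = (A ** averaging) ** Xstar" by (metis matrix_mul_assoc)
  also have "\<dots> = 0" by (simp add: A.mult_averaging)
  finally show ?thesis .
qed

text \<open>Average zero expresses membership in the range of \<open>A\<close>, the orthogonal
  complement of the constants. \<open>D 1\<close> is in this range by its form
  \<open>A ** Z\<close>, and each update adds an element of it.\<close>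

lemma averaging_D: "1 \<le> k \<Longrightarrow> \<omega> \<in> space M \<Longrightarrow> averaging ** D k \<omega> = 0"
proof (induction k rule: dec_induct)
  case base
  then show ?case by (simp add: path_init matrix_mul_assoc A.averaging_mult)
next
  case (step k)
  have "averaging ** (c *\<^sub>R (A ** V)) = 0" for c and V :: "real^'d^'n"
    by (simp add: linear_scale[OF bounded_linear.linear[OF bounded_linear_matrix_mult]] matrix_mul_assoc A.averaging_mult)
  then show ?case
    unfolding path_step(2)[OF step.prems step.hyps(1)]
    by (subst matrix_add_ldistrib) (simp add: step.IH step.prems)
qed

text \<open>The distance from \<open>- grad Xstar\<close>, the dual value at which
  \<open>Xstar\<close> is a fixed point of the exact \<open>X\<close> update; hence the plus
  sign.\<close>

definition gap_D :: "nat \<Rightarrow> 'a \<Rightarrow> real^'d^'n" where "gap_D k \<omega> = D k \<omega> + grad Xstar"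

lemma averaging_gap_D:
  assumes "1 \<le> k" "\<omega> \<in> space M" shows "averaging ** gap_D k \<omega> = 0"
proof -
  have "averaging ** grad Xstar = 0"
    by (subst vec_eq_iff) (simp add: averaging_mult_nth grad_def Xstar_def stationary)
  then show ?thesis using averaging_D[OF assms] by (simp add: gap_D_def matrix_add_ldistrib)
qed

lemma pseudoinverse_mult_range:
  fixes d v :: "real^'d^'n"
  assumes "averaging ** d = 0"
  shows "d \<bullet> (P ** (A ** v)) = d \<bullet> v"
proof -
  have "P ** (A ** v) = (mat 1 - averaging) ** v"
    by (simp add: matrix_mul_assoc A.pseudoinverse_mult)
  also have "\<dots> = mat 1 ** v - averaging ** v"
    by (simp add: vec_eq_iff matrix_matrix_mult_def left_diff_distrib sum_subtractf)
  also have "\<dots> = v - averaging ** v" by simp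
  finally show ?thesis
    using matrix_mult_inner_sym[OF transpose_averaging, of d v] assms by (simp add: inner_diff_right)
qed

text \<open>Plain expansion of the square, by monotonicity and the Lipschitz bound. The factor is
  cruder than the sharp one for a gradient step, but it is applied only to small \<open>t\<close>,
  where \<open>L\<^sup>2 * t\<^sup>2\<close> is a small fraction of
  \<open>\<mu> * t\<close>.\<close>

lemma gradient_step_contraction:
  assumes "0 \<le> t"
  shows "(norm ((V - Xstar) - t *\<^sub>R (grad V - grad Xstar)))\<^sup>2 \<le> (1 - 2 * \<mu> * t + L\<^sup>2 * t\<^sup>2) * (norm (V - Xstar))\<^sup>2"
proof -
  have lip: "(norm (grad V - grad Xstar))\<^sup>2 \<le> L\<^sup>2 * (norm (V - Xstar))\<^sup>2"
    unfolding norm_vec_square[of "_ :: real^'d^'n"] sum_distrib_left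
    by (intro sum_mono) (simp only: grad_def vector_minus_component vec_lambda_beta lipschitz)
  have mon: "\<mu> * (norm (V - Xstar))\<^sup>2 \<le> (grad V - grad Xstar) \<bullet> (V - Xstar)"
    unfolding norm_vec_square[of "_ :: real^'d^'n"] sum_distrib_left inner_vec_def[of "_ :: real^'d^'n"]
    by (intro sum_mono) (simp only: grad_def vector_minus_component vec_lambda_beta monotone)
  have "(norm ((V - Xstar) - t *\<^sub>R (grad V - grad Xstar)))\<^sup>2 = (norm (V - Xstar))\<^sup>2
      - 2 * t * ((grad V - grad Xstar) \<bullet> (V - Xstar)) + t\<^sup>2 * (norm (grad V - grad Xstar))\<^sup>2"
    unfolding power2_norm_eq_inner
    by (simp only: inner_diff_left inner_diff_right inner_scaleR_left inner_scaleR_right)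
       (simp add: inner_commute power2_eq_square algebra_simps)
  also have "\<dots> \<le> (norm (V - Xstar))\<^sup>2 - 2 * t * (\<mu> * (norm (V - Xstar))\<^sup>2) + t\<^sup>2 * (L\<^sup>2 * (norm (V - Xstar))\<^sup>2)"
    using assms by (intro add_mono diff_mono mult_left_mono lip mon order_refl) auto
  finally show ?thesis by (simp add: algebra_simps)
qed

section \<open>Expected errors and their decrease in one iteration\<close>

definition err_X :: "nat \<Rightarrow> real" where "err_X k = expectation (\<lambda>\<omega>. (norm (X k \<omega> - Xstar))\<^sup>2)"
definition err_D :: "nat \<Rightarrow> real" where "err_D k = expectation (\<lambda>\<omega>. gap_D k \<omega> \<bullet> (P ** gap_D k \<omega>))"
definition err_H :: "nat \<Rightarrow> real" where "err_H k = expectation (\<lambda>\<omega>. (norm (H k \<omega> - Xstar))\<^sup>2)"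

lemma err_nonneg: "0 \<le> err_X k" "0 \<le> err_D k" "0 \<le> err_H k"
  by (auto simp: err_X_def err_D_def err_H_def intro!: integral_nonneg_AE pair.psdB)

lemma gap_integrable:
  "integrable M (\<lambda>\<omega>. (norm (X k \<omega> - Xstar))\<^sup>2)"
  "1 \<le> k \<Longrightarrow> integrable M (\<lambda>\<omega>. (norm (H k \<omega> - Xstar))\<^sup>2)"
  "1 \<le> k \<Longrightarrow> square_integrable M (gap_D k)"
  "1 \<le> k \<Longrightarrow> integrable M (\<lambda>\<omega>. gap_D k \<omega> \<bullet> (P ** gap_D k \<omega>))"
proof -
  show "integrable M (\<lambda>\<omega>. (norm (X k \<omega> - Xstar))\<^sup>2)"
    using square_integrable_diff[OF state_square_integrable(1) square_integrable_const]
    by (simp add: square_integrable_def)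
  assume k: "1 \<le> k"
  show "integrable M (\<lambda>\<omega>. (norm (H k \<omega> - Xstar))\<^sup>2)"
    using square_integrable_diff[OF state_square_integrable(2)[OF k] square_integrable_const]
    by (simp add: square_integrable_def)
  show gap: "square_integrable M (gap_D k)"
    using square_integrable_add[OF state_square_integrable(3)[OF k] square_integrable_const]
    by (simp add: gap_D_def[abs_def])
  show "integrable M (\<lambda>\<omega>. gap_D k \<omega> \<bullet> (P ** gap_D k \<omega>))"
    by (intro square_integrable_inner gap square_integrable_bounded_linear[OF bounded_linear_matrix_mult])
qed

text \<open>\<open>m\<close> is the error after an exact gradient step, known before sampling;
  \<open>b\<close> is the coefficient of the compression error, known before compression. These are
  the vectors against which the two noises are uncorrelated.\<close>

context
  fixes k :: nat and p :: real and m :: "'a \<Rightarrow> real^'d^'n" and b :: "'a \<Rightarrow> real^'d^'n"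
  assumes k: "1 \<le> k" and \<eta>: "0 < \<eta> k" and \<gamma>: "0 < \<gamma> k"
    and \<alpha>: "\<alpha> k = C * \<beta> * \<gamma> k / (2 * (1 + C))"
  defines "p \<equiv> C * \<beta> * \<gamma> k"
    and "m \<equiv> \<lambda>\<omega>. (X k \<omega> - Xstar) - \<eta> k *\<^sub>R (grad (X k \<omega>) - grad Xstar)"
    and "b \<equiv> \<lambda>\<omega>. (2 * \<eta> k) *\<^sub>R gap_D k \<omega> + ((\<gamma> k)\<^sup>2 * \<beta> / 2) *\<^sub>R (A ** (Y k \<omega> - Xstar))
      + (2 * p) *\<^sub>R ((1 - \<alpha> k) *\<^sub>R (H k \<omega> - Xstar) + \<alpha> k *\<^sub>R (Y k \<omega> - Xstar))"
begin

text \<open>The two inner products with the noises have no sign along a path, so they are kept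
  exactly and not estimated; taking expectations removes them.\<close>

lemma lyapunov_step_pathwise:
  assumes \<omega>: "\<omega> \<in> space M" and p_small: "0 < p" "p \<le> 1 / 64" and small: "\<gamma> k * \<beta> \<le> 2"
  shows "(norm (X (Suc k) \<omega> - Xstar))\<^sup>2
      + 2 * (\<eta> k)\<^sup>2 / \<gamma> k * (gap_D (Suc k) \<omega> \<bullet> (P ** gap_D (Suc k) \<omega>))
      + 2 * (1 + C) * (norm (H (Suc k) \<omega> - Xstar))\<^sup>2
    \<le> (1 + 9 / 8 * p) * ((1 - 2 * \<mu> * \<eta> k + L\<^sup>2 * (\<eta> k)\<^sup>2) * (norm (X k \<omega> - Xstar))\<^sup>2
        + (\<eta> k)\<^sup>2 * (norm (grad_noise k \<omega>))\<^sup>2)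
      - (1 + 9 / 8 * p) * 2 * \<eta> k * (m \<omega> \<bullet> grad_noise k \<omega>)
      + 2 * (\<eta> k)\<^sup>2 / \<gamma> k * (1 - 3 * \<gamma> k / (8 * \<kappa>)) * (gap_D k \<omega> \<bullet> (P ** gap_D k \<omega>))
      + 2 * (1 + C) * (1 - \<alpha> k) * (norm (H k \<omega> - Xstar))\<^sup>2
      - p * (1 - \<alpha> k) * (norm (Y k \<omega> - H k \<omega>))\<^sup>2
      + (\<gamma> k * \<beta> / 2 * (1 + \<gamma> k * \<beta> / 2) + p * \<alpha> k) * (norm (comp_noise k \<omega>))\<^sup>2
      + b \<omega> \<bullet> comp_noise k \<omega>"
proof -
  define d where "d = gap_D k \<omega>"
  define xt where "xt = m \<omega> - \<eta> k *\<^sub>R grad_noise k \<omega>"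
  define y where "y = Y k \<omega> - Xstar"
  define e where "e = comp_noise k \<omega>"
  define h where "h = H k \<omega> - Xstar"
  have AY: "A ** (Y k \<omega> + e) = A ** (y + e)"
  proof -
    have "A ** (Y k \<omega> + e) = A ** ((y + e) + Xstar)" by (simp add: y_def algebra_simps)
    also have "\<dots> = A ** (y + e)" by (simp only: matrix_add_ldistrib A_Xstar add_0_right)
    finally show ?thesis .
  qed
  have y: "y = xt - \<eta> k *\<^sub>R d"
    by (simp add: y_def xt_def d_def Y_def m_def grad_noise_def gap_D_def algebra_simps)
  have d': "gap_D (Suc k) \<omega> = d + (\<gamma> k / (2 * \<eta> k)) *\<^sub>R (A ** (y + e))"
    by (simp only: gap_D_def d_def path_step(2)[OF \<omega> k] AY flip: e_def) (simp add: algebra_simps)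
  have x': "X (Suc k) \<omega> - Xstar = y - (\<gamma> k / 2) *\<^sub>R (A ** (y + e))"
  proof -
    have "X (Suc k) \<omega> - Xstar = y - \<eta> k *\<^sub>R ((\<gamma> k / (2 * \<eta> k)) *\<^sub>R (A ** (y + e)))"
      by (simp only: path_step(2,3)[OF \<omega> k] AY flip: e_def) (simp add: y_def Y_def algebra_simps)
    then show ?thesis using \<eta> by simp
  qed
  have h': "H (Suc k) \<omega> - Xstar = (1 - \<alpha> k) *\<^sub>R h + \<alpha> k *\<^sub>R (y + e)"
    by (simp only: path_step(1)[OF \<omega> k] flip: e_def) (simp add: h_def y_def algebra_simps)
  have d_range: "d \<bullet> (P ** (A ** v)) = d \<bullet> v" for v
    by (rule pseudoinverse_mult_range) (simp add: d_def averaging_gap_D[OF k \<omega>])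
  have A_range: "(A ** u) \<bullet> (P ** (A ** v)) = (A ** u) \<bullet> v" for u v :: "real^'d^'n"
    by (rule pseudoinverse_mult_range) (simp add: matrix_mul_assoc A.averaging_mult)
  have b: "b \<omega> = (2 * \<eta> k) *\<^sub>R d + ((\<gamma> k)\<^sup>2 * \<beta> / 2) *\<^sub>R (A ** y) + (2 * p) *\<^sub>R ((1 - \<alpha> k) *\<^sub>R h + \<alpha> k *\<^sub>R y)"
    by (simp add: b_def d_def y_def h_def)
  have yh: "y - h = Y k \<omega> - H k \<omega>" by (simp add: y_def h_def)
  note main = pair.lyapunov_step[OF \<eta> \<gamma> C_nonneg small \<alpha> p_def[THEN meta_eq_to_obj_eq] d_range A_range y d' x' h' b]
  have 1: "p * (norm y)\<^sup>2 \<le> 9 / 8 * p * (norm xt)\<^sup>2 + (\<eta> k)\<^sup>2 * (norm d)\<^sup>2 / 4"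
    using young_eighth[OF p_small, of xt "\<eta> k *\<^sub>R d"] by (simp add: y power_mult_distrib)
  \<comment> \<open>Three quarters of \<open>(\<eta> k)\<^sup>2 * (norm d)\<^sup>2\<close> survive
    the estimate \<open>1\<close>. The bound of the form of \<open>P\<close> by \<kappa> converts
    them into a share of the dual term, which relative to its weight
    \<open>2 * (\<eta> k)\<^sup>2 / \<gamma> k\<close> is
    \<open>3 * \<gamma> k / (8 * \<kappa>)\<close>.\<close>
  have "(3 / 4 * (\<eta> k)\<^sup>2 / \<kappa>) * (d \<bullet> (P ** d)) \<le> (3 / 4 * (\<eta> k)\<^sup>2 / \<kappa>) * (\<kappa> * (norm d)\<^sup>2)"
    using \<kappa>_pos by (intro mult_left_mono pair.B_le) simp
  then have 2: "(3 / 4 * (\<eta> k)\<^sup>2 / \<kappa>) * (d \<bullet> (P ** d)) \<le> 3 / 4 * ((\<eta> k)\<^sup>2 * (norm d)\<^sup>2)"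
    using \<kappa>_pos by simp
  have 3: "(norm xt)\<^sup>2 \<le> (1 - 2 * \<mu> * \<eta> k + L\<^sup>2 * (\<eta> k)\<^sup>2) * (norm (X k \<omega> - Xstar))\<^sup>2
      + (\<eta> k)\<^sup>2 * (norm (grad_noise k \<omega>))\<^sup>2 - 2 * \<eta> k * (m \<omega> \<bullet> grad_noise k \<omega>)" (is "_ \<le> ?r")
  proof -
    have "(norm xt)\<^sup>2 = (norm (m \<omega>))\<^sup>2 - 2 * \<eta> k * (m \<omega> \<bullet> grad_noise k \<omega>) + (\<eta> k)\<^sup>2 * (norm (grad_noise k \<omega>))\<^sup>2"
      unfolding xt_def power2_norm_eq_inner
      by (simp add: inner_diff_left inner_diff_right inner_commute power2_eq_square algebra_simps)
    with gradient_step_contraction[of "\<eta> k" "X k \<omega>"] \<eta> show ?thesis by (simp add: m_def)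
  qed
  have 4: "(1 + 9 / 8 * p) * (norm xt)\<^sup>2 \<le> (1 + 9 / 8 * p) * ?r"
    by (rule mult_left_mono[OF 3]) (use p_small in simp)
  have 5: "2 * (\<eta> k)\<^sup>2 / \<gamma> k * (1 - 3 * \<gamma> k / (8 * \<kappa>)) * (d \<bullet> (P ** d))
      = 2 * (\<eta> k)\<^sup>2 / \<gamma> k * (d \<bullet> (P ** d)) - (3 / 4 * (\<eta> k)\<^sup>2 / \<kappa>) * (d \<bullet> (P ** d))"
    using \<gamma> \<kappa>_pos by (simp add: field_simps)
  have 6: "(1 + 9 / 8 * p) * (norm xt)\<^sup>2 = (norm xt)\<^sup>2 + 9 / 8 * p * (norm xt)\<^sup>2"
    "(1 + 9 / 8 * p) * (u + v - 2 * \<eta> k * w) = (1 + 9 / 8 * p) * (u + v) - (1 + 9 / 8 * p) * 2 * \<eta> k * w" for u v w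
    by (simp_all only: distrib_right mult_1 right_diff_distrib mult.assoc)
  show ?thesis
    unfolding d_def[symmetric] e_def[symmetric] h_def[symmetric] yh[symmetric] 5
    using main 1 2 4 unfolding 6 by linarith
qed

text \<open>The smallness conditions have distinct tasks: \<open>p \<le> 1 / 64\<close> serves
  Young's inequality and the factor \<open>2\<close> of the noise,
  \<open>p \<le> \<mu> * \<eta> k\<close> and \<open>\<eta>_small\<close> the primal factor, and
  \<open>small\<close> the compression variance.\<close>

lemma lyapunov_step_expectation:
  assumes C: "0 < C" and p_small: "p \<le> 1 / 64" "p \<le> \<mu> * \<eta> k" and small: "(2 * C + 1) * (\<gamma> k * \<beta>) \<le> 2"
    and \<eta>_small: "16 * L\<^sup>2 * \<eta> k \<le> \<mu>"
  shows "err_X (Suc k) + 2 * (\<eta> k)\<^sup>2 / \<gamma> k * err_D (Suc k) + 2 * (1 + C) * err_H (Suc k)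
    \<le> (1 - 3 / 4 * (\<mu> * \<eta> k)) * err_X k + 2 * (\<eta> k)\<^sup>2 / \<gamma> k * (1 - 3 * \<gamma> k / (8 * \<kappa>)) * err_D k
      + 2 * (1 + C) * (1 - \<alpha> k) * err_H k + 2 * (\<Sum>i\<in>UNIV. (\<sigma> i)\<^sup>2) * (\<eta> k)\<^sup>2"
proof -
  have g\<beta>: "0 < \<gamma> k * \<beta>" using \<gamma> \<beta>_pos by simp
  have p_pos: "0 < p" using C \<gamma> \<beta>_pos by (simp add: p_def)
  have "\<gamma> k * \<beta> \<le> (2 * C + 1) * (\<gamma> k * \<beta>)" using g\<beta> C by (simp add: algebra_simps)
  then have small1: "\<gamma> k * \<beta> \<le> 2" using small by linarith
  let ?F = "before_gradient k"
  have mono: "u \<in> borel_measurable (before_compression k)" if "u \<in> borel_measurable ?F" for u :: "'a \<Rightarrow> real^'d^'n"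
    using that by (rule measurable_past_mono[rotated]) auto
  note XF = state_measurable(1)[of k] and HF = mono[OF state_measurable(2)[OF k]]
    and DF = mono[OF state_measurable(3)[OF k]]
  note sX = state_square_integrable(1)[of k] and sH = state_square_integrable(2)[OF k]
    and sD = state_square_integrable(3)[OF k]
  note sY = Y_square_integrable[OF sX sD]
  note sYH = square_integrable_diff[OF sY sH]
  note sd = gap_integrable(3)[OF k]
  note se = comp_noise_square_integrable[OF k sYH]
  note sw = grad_noise_square_integrable[of k]
  have YF: "Y k \<in> borel_measurable (before_compression k)"
    by (rule Y_measurable[OF mono[OF XF] DF]) auto
  have sm: "square_integrable M m"
    unfolding m_def
    by (intro square_integrable_diff square_integrable_scaleR grad_square_integrable sX square_integrable_const)
  have mF: "m \<in> borel_measurable ?F"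
    unfolding m_def
    by (intro borel_measurable_diff borel_measurable_scaleR grad_measurable XF borel_measurable_const)
  have sb: "square_integrable M b"
    unfolding b_def
    by (intro square_integrable_add square_integrable_scaleR sd square_integrable_diff sY sH
        square_integrable_const square_integrable_bounded_linear[OF bounded_linear_matrix_mult])
  have bF: "b \<in> borel_measurable (before_compression k)"
    unfolding b_def gap_D_def
    by (intro borel_measurable_add borel_measurable_scaleR borel_measurable_const borel_measurable_diff
        YF HF DF matrix_mult_measurable)
  \<comment> \<open>With every term known to be integrable, the simplifier can split expectations
    and discharge the conditions of \<open>integral_mono\<close>.\<close>
  note [simp] = gap_integrable(1)[of k] gap_integrable(1)[of "Suc k"] gap_integrable(2,4)[OF k]
    gap_integrable(2,4)[of "Suc k", simplified]
    square_integrable_inner[OF sm sw] square_integrable_inner[OF sb se]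
    sw[unfolded square_integrable_def, THEN conjunct2] se[unfolded square_integrable_def, THEN conjunct2]
    sYH[unfolded square_integrable_def, THEN conjunct2]
  define ew where "ew = expectation (\<lambda>\<omega>. (norm (grad_noise k \<omega>))\<^sup>2)"
  define ee where "ee = expectation (\<lambda>\<omega>. (norm (comp_noise k \<omega>))\<^sup>2)"
  define yh where "yh = expectation (\<lambda>\<omega>. (norm (Y k \<omega> - H k \<omega>))\<^sup>2)"
  define c3 where "c3 = \<gamma> k * \<beta> / 2 * (1 + \<gamma> k * \<beta> / 2) + p * \<alpha> k"
  define r where "r = 1 - 2 * \<mu> * \<eta> k + L\<^sup>2 * (\<eta> k)\<^sup>2"
  have "err_X (Suc k) + 2 * (\<eta> k)\<^sup>2 / \<gamma> k * err_D (Suc k) + 2 * (1 + C) * err_H (Suc k)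
    = expectation (\<lambda>\<omega>. (norm (X (Suc k) \<omega> - Xstar))\<^sup>2
      + 2 * (\<eta> k)\<^sup>2 / \<gamma> k * (gap_D (Suc k) \<omega> \<bullet> (P ** gap_D (Suc k) \<omega>))
      + 2 * (1 + C) * (norm (H (Suc k) \<omega> - Xstar))\<^sup>2)"
    by (simp add: err_X_def err_D_def err_H_def)
  also have "\<dots> \<le> expectation (\<lambda>\<omega>. (1 + 9 / 8 * p) * (r * (norm (X k \<omega> - Xstar))\<^sup>2
        + (\<eta> k)\<^sup>2 * (norm (grad_noise k \<omega>))\<^sup>2)
      - (1 + 9 / 8 * p) * 2 * \<eta> k * (m \<omega> \<bullet> grad_noise k \<omega>)
      + 2 * (\<eta> k)\<^sup>2 / \<gamma> k * (1 - 3 * \<gamma> k / (8 * \<kappa>)) * (gap_D k \<omega> \<bullet> (P ** gap_D k \<omega>))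
      + 2 * (1 + C) * (1 - \<alpha> k) * (norm (H k \<omega> - Xstar))\<^sup>2
      - p * (1 - \<alpha> k) * (norm (Y k \<omega> - H k \<omega>))\<^sup>2
      + c3 * (norm (comp_noise k \<omega>))\<^sup>2
      + b \<omega> \<bullet> comp_noise k \<omega>)"
    unfolding r_def c3_def
    by (rule integral_mono[OF _ _ lyapunov_step_pathwise[OF _ p_pos p_small(1) small1]]) simp_all
  also have "\<dots> = (1 + 9 / 8 * p) * (r * err_X k + (\<eta> k)\<^sup>2 * ew)
      + 2 * (\<eta> k)\<^sup>2 / \<gamma> k * (1 - 3 * \<gamma> k / (8 * \<kappa>)) * err_D k + 2 * (1 + C) * (1 - \<alpha> k) * err_H k
      - p * (1 - \<alpha> k) * yh + c3 * ee"
    using grad_noise_uncorrelated[OF sm mF] comp_noise_uncorrelated[OF k sYH sb bF]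
    by (simp add: err_X_def err_D_def err_H_def ew_def ee_def yh_def)
  also have "\<dots> \<le> (1 - 3 / 4 * (\<mu> * \<eta> k)) * err_X k + 2 * (\<Sum>i\<in>UNIV. (\<sigma> i)\<^sup>2) * (\<eta> k)\<^sup>2
      + 2 * (\<eta> k)\<^sup>2 / \<gamma> k * (1 - 3 * \<gamma> k / (8 * \<kappa>)) * err_D k + 2 * (1 + C) * (1 - \<alpha> k) * err_H k"
  proof -
    have "0 \<le> yh" by (simp add: yh_def)
    have c3_nonneg: "0 \<le> c3" using g\<beta> p_pos C \<gamma> \<beta>_pos by (simp add: c3_def \<alpha>)
    have "c3 * ee \<le> c3 * (C * yh)"
      unfolding ee_def yh_def by (rule mult_left_mono[OF comp_noise_variance[OF k sYH] c3_nonneg])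
    \<comment> \<open>To leading order the compression noise costs \<open>c3 * C\<close>, about
      \<open>p / 2\<close>, against the available \<open>p\<close>. The exact surplus is
      \<open>p / 4 * (2 - (2 * C + 1) * (\<gamma> k * \<beta>))\<close>, which \<open>small\<close>
      makes nonnegative.\<close>
    also have "\<dots> \<le> (p * (1 - \<alpha> k)) * yh"
    proof -
      have "x / (2 * c) * c = x / 2" if "c \<noteq> 0" for x c :: real using that by simp
      from this[of "1 + C" "C * \<beta> * \<gamma> k"] have \<alpha>C: "\<alpha> k * (1 + C) = p / 2"
        using C unfolding \<alpha> p_def by linarith
      have "p * (1 - \<alpha> k) - c3 * C = p * (1 / 2 - \<gamma> k * \<beta> / 4 - \<alpha> k * (1 + C))"
        by (simp add: c3_def p_def algebra_simps)
      also have "\<dots> = p / 4 * (2 - (2 * C + 1) * (\<gamma> k * \<beta>))"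
        unfolding \<alpha>C by (simp add: p_def algebra_simps)
      also have "0 \<le> \<dots>" using small p_pos by simp
      finally have "c3 * C \<le> p * (1 - \<alpha> k)" by simp
      from mult_right_mono[OF this \<open>0 \<le> yh\<close>] show ?thesis by (simp add: mult.assoc)
    qed
    finally have 1: "c3 * ee \<le> p * (1 - \<alpha> k) * yh" .
    have 2: "(1 + 9 / 8 * p) * r \<le> 1 - 3 / 4 * (\<mu> * \<eta> k)"
    proof -
      define t where "t = \<mu> * \<eta> k"
      have "0 < t" using \<mu>_pos \<eta> by (simp add: t_def)
      have "16 * L\<^sup>2 * \<eta> k * \<eta> k \<le> \<mu> * \<eta> k" using \<eta>_small \<eta> by (intro mult_right_mono) auto
      \<comment> \<open>\<open>31 / 16\<close> is \<open>2\<close> less the sixteenth conceded to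
        \<open>L\<^sup>2\<close>. The inflation by \<open>9 / 8 * p\<close> costs at most another
        \<open>9 / 8 * t\<close>, and the remaining \<open>13 / 16\<close> exceeds
        \<open>3 / 4\<close>.\<close>
      then have "r \<le> 1 - 31 / 16 * t" by (simp add: r_def t_def power2_eq_square)
      then have "(1 + 9 / 8 * p) * r \<le> (1 + 9 / 8 * p) * (1 - 31 / 16 * t)"
        using p_pos by (intro mult_left_mono) auto
      also have "\<dots> = 1 - 31 / 16 * t + 9 / 8 * p - 279 / 128 * (p * t)" by (simp add: algebra_simps)
      also have "\<dots> \<le> 1 - 3 / 4 * t"
        using p_small(2) mult_pos_pos[OF p_pos \<open>0 < t\<close>] \<open>0 < t\<close> unfolding t_def[symmetric] by linarith
      finally show ?thesis by (simp add: t_def)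
    qed
    have 3: "(1 + 9 / 8 * p) * (r * err_X k) \<le> (1 - 3 / 4 * (\<mu> * \<eta> k)) * err_X k"
      using mult_right_mono[OF 2 err_nonneg(1)[of k]] by (simp add: mult.assoc)
    have "(1 + 9 / 8 * p) * ((\<eta> k)\<^sup>2 * ew) \<le> 2 * ((\<eta> k)\<^sup>2 * (\<Sum>i\<in>UNIV. (\<sigma> i)\<^sup>2))"
      unfolding ew_def using p_pos p_small(1)
      by (intro mult_mono mult_left_mono grad_noise_variance) auto
    with 1 3 show ?thesis by (simp add: distrib_left algebra_simps)
  qed
  finally show ?thesis by simp
qed

end

end

section \<open>The convergence rate\<close>

text \<open>The upper bound on \<theta> makes the second entry positive; the third is positive
  because \<open>C > 0\<close> puts the square root strictly below \<open>3 * C + 1\<close>.\<close>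

lemma step_constant_pos:
  fixes C \<mu> L \<beta> \<theta> :: real
  assumes "0 < C" "0 < \<beta>" "0 < \<theta>" "0 < \<mu>" "\<mu> \<le> L" "\<theta> < \<mu> / (C * \<beta>)"
  shows "0 < Min {2 / (\<mu> + L), 2 * (\<mu> - C * \<beta> * \<theta>) / \<mu>\<^sup>2,
    ((3 * C + 1) - sqrt ((3 * C + 1)\<^sup>2 - 4 * C)) / (C * \<beta> * \<theta>), 2 / (\<beta> * \<theta>)}"
proof -
  have "C * \<beta> * \<theta> < \<mu>"
    using assms by (simp add: pos_less_divide_eq mult.commute)
  moreover have "sqrt ((3 * C + 1)\<^sup>2 - 4 * C) < 3 * C + 1"
    using assms(1) by (intro real_less_lsqrt) auto
  ultimately show ?thesis using assms by simp
qed

theorem theorem2: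
  fixes M :: "'a measure"
    and E :: "'n::finite \<Rightarrow> 'n \<Rightarrow> bool"
    and W :: "real^'n^'n"
    and f :: "'n \<Rightarrow> real^'d::finite \<Rightarrow> real"
    and gradf :: "'n \<Rightarrow> real^'d \<Rightarrow> real^'d"
    and xstar :: "real^'d"
    and S :: "'n \<Rightarrow> 's measure"
    and g :: "'n \<Rightarrow> real^'d \<Rightarrow> 's \<Rightarrow> real^'d"
    and R :: "'t measure"
    and q :: "real^'d \<Rightarrow> 't \<Rightarrow> real^'d"
    and \<xi> :: "nat \<Rightarrow> 'a \<Rightarrow> 'n \<Rightarrow> 's"
    and \<zeta> :: "nat \<Rightarrow> 'a \<Rightarrow> 'n \<Rightarrow> 't"
    and \<sigma> :: "'n \<Rightarrow> real"
    and C L \<mu> \<beta> \<theta>\<^sub>1 \<theta>\<^sub>2 \<theta>\<^sub>3 \<theta>\<^sub>4 \<theta>\<^sub>5 \<eta>star :: real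
    and \<eta> \<gamma> \<alpha> :: "nat \<Rightarrow> real"
    and X0 H1 Z :: "real^'d^'n"
    and X H D :: "nat \<Rightarrow> 'a \<Rightarrow> real^'d^'n"
    and err :: "nat \<Rightarrow> real"
  assumes "prob_space M"
    and "connected_graph E" and "mixing_matrix E W"
    and "0 \<le> C" and "unbiased_contracted C R q"
    and "\<And>i. stochastic_gradient (\<sigma> i) (S i) (g i) (gradf i)"
    and "fresh_randomness M S R \<xi> \<zeta>"
    and "0 < \<mu>" and "\<mu> \<le> L"
    and "\<And>i. smooth_strongly_convex (f i) (gradf i) L \<mu>"
    and "is_arg_min (\<lambda>x. 1 / real CARD('n) * (\<Sum>i\<in>UNIV. f i x)) (\<lambda>_. True) xstar"
    and "\<beta> = lambda_max (mat 1 - W)"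
    and "\<theta>\<^sub>1 = 1 / (2 * lambda_max (pseudoinverse (mat 1 - W)))"
    and "\<theta>\<^sub>2 = C * \<beta> / (2 * (1 + C))"
    and "\<theta>\<^sub>3 = min \<theta>\<^sub>1 \<theta>\<^sub>2"
    and "\<theta>\<^sub>4 \<in> {0 <..< \<mu> / (C * \<beta>)}"
    and "\<eta>star = 2 * (\<mu> - C * \<beta> * \<theta>\<^sub>4) / \<mu>\<^sup>2"
    and "\<theta>\<^sub>5 = Min {2 / (\<mu> + L), \<eta>star,
                  ((3 * C + 1) - sqrt ((3 * C + 1)\<^sup>2 - 4 * C)) / (C * \<beta> * \<theta>\<^sub>4),
                  2 / (\<beta> * \<theta>\<^sub>4)}"
    and "\<And>k. \<eta> k = 2 * \<theta>\<^sub>5 / (\<theta>\<^sub>3 * \<theta>\<^sub>4 * \<theta>\<^sub>5 * real k + 2)"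
    and "\<And>k. \<gamma> k = \<theta>\<^sub>4 * \<eta> k"
    and "\<And>k. \<alpha> k = C * \<beta> * \<gamma> k / (2 * (1 + C))"
    and "\<And>\<omega>. \<omega> \<in> space M \<Longrightarrow>
           lead_path W g q \<eta> \<gamma> \<alpha> X0 H1 Z (\<lambda>k. \<xi> k \<omega>) (\<lambda>k. \<zeta> k \<omega>)
             (\<lambda>k. X k \<omega>) (\<lambda>k. H k \<omega>) (\<lambda>k. D k \<omega>)"
    and "\<And>k. err k = 1 / real CARD('n) *
           (\<Sum>i\<in>UNIV. prob_space.expectation M (\<lambda>\<omega>. (norm (X k \<omega> $ i - xstar))\<^sup>2))"
  shows "(\<forall>k i. integrable M (\<lambda>\<omega>. (norm (X k \<omega> $ i - xstar))\<^sup>2)) \<and>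
         err \<in> O(\<lambda>k. 1 / real k) \<and>
         (\<exists>K :: real \<Rightarrow> nat. (\<forall>\<epsilon>>0. \<forall>k\<ge>K \<epsilon>. err k \<le> \<epsilon>) \<and>
            (\<lambda>\<epsilon>. real (K \<epsilon>)) \<in> O[at_right 0](\<lambda>\<epsilon>. 1 / \<epsilon>))"
proof -
  define A where "A = mat 1 - W"
  have \<beta>_def: "\<beta> = lambda_max A" by (simp add: A_def assms(12))
  have ker: "averaging_kernel A" unfolding A_def by (rule mixing_matrix_averaging_kernel[OF assms(3)])
  have "0 \<le> \<beta>" unfolding \<beta>_def by (rule averaging_kernel.lambda_max_nonneg[OF ker])
  have \<theta>\<^sub>4: "0 < \<theta>\<^sub>4" "\<theta>\<^sub>4 < \<mu> / (C * \<beta>)" using assms(16) by auto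
  \<comment> \<open>The range of \<open>\<theta>\<^sub>4\<close> is empty when \<open>C * \<beta> = 0\<close>, as then \<open>\<mu> / (C * \<beta>) = 0\<close>.\<close>
  then have "C \<noteq> 0" "\<beta> \<noteq> 0" by auto
  then have C: "0 < C" and \<beta>: "0 < \<beta>" using assms(4) \<open>0 \<le> \<beta>\<close> by linarith+
  have \<mu>: "0 < \<mu>" and L: "0 < L" using assms(8,9) by auto
  have C\<beta>\<theta>: "C * \<beta> * \<theta>\<^sub>4 < \<mu>"
    using \<theta>\<^sub>4(2) C \<beta> by (simp add: pos_less_divide_eq mult.commute)
  have stationary: "(\<Sum>i\<in>UNIV. gradf i xstar) = 0"
  proof (rule sum_gradients_minimizer[OF assms(10) L])
    show "(\<Sum>i\<in>UNIV. f i xstar) \<le> (\<Sum>i\<in>UNIV. f i x)" for x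
      using assms(11) by (auto simp: is_arg_min_linorder divide_le_cancel)
  qed
  interpret lead_analysis M W g gradf S R q \<xi> \<zeta> \<sigma> C L \<eta> \<gamma> \<alpha> X0 H1 Z X H D xstar \<mu>
  proof (intro lead_analysis.intro lead_process.intro lead_process_axioms.intro lead_analysis_axioms.intro)
    show "averaging_kernel (mat 1 - W)" using ker by (simp add: A_def)
    show "0 < lambda_max (mat 1 - W)" using \<beta> by (simp add: \<beta>_def A_def)
    show "(norm (gradf i x - gradf i y))\<^sup>2 \<le> L\<^sup>2 * (norm (x - y))\<^sup>2" for i x y
      by (rule lipschitz_gradient[OF assms(10) assms(8,9)])
    show "\<mu> * (norm (x - y))\<^sup>2 \<le> (gradf i x - gradf i y) \<bullet> (x - y)" for i x y
      by (rule strongly_monotone_gradient[OF assms(10)])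
  qed ((rule assms(1,4,5,6,7,8,22) stationary, assumption?)+)
  define \<kappa> where "\<kappa> = lambda_max (pseudoinverse A)"
  have \<kappa>: "0 < \<kappa>" unfolding \<kappa>_def A_def by (rule \<kappa>_pos)
  have \<theta>\<^sub>1: "\<theta>\<^sub>1 = 1 / (2 * \<kappa>)" using assms(13) by (simp add: \<kappa>_def A_def)
  have \<theta>\<^sub>2: "\<theta>\<^sub>2 = C * \<beta> / (2 * (1 + C))" by (rule assms(14))
  have \<theta>\<^sub>3: "0 < \<theta>\<^sub>3" "\<theta>\<^sub>3 \<le> \<theta>\<^sub>1" "\<theta>\<^sub>3 \<le> \<theta>\<^sub>2"
    using C \<beta> \<kappa> unfolding assms(15) \<theta>\<^sub>1 \<theta>\<^sub>2 by auto
  have \<theta>\<^sub>5: "0 < \<theta>\<^sub>5"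
    unfolding assms(17,18) by (rule step_constant_pos[OF C \<beta> \<theta>\<^sub>4(1) \<mu> assms(9) \<theta>\<^sub>4(2)])
  define c where "c = \<theta>\<^sub>3 * \<theta>\<^sub>4"
  \<comment> \<open>Brings the step size into the form \<open>2 / c / (k + b)\<close>, so that the
    contraction \<open>3 / 4 * (c * \<eta> k)\<close> equals \<open>3 / 2 / (k + b)\<close>, as
    \<open>chung_recursion\<close> requires.\<close>
  define b where "b = 2 / (c * \<theta>\<^sub>5)"
  have c: "0 < c" and b: "0 < b" using \<theta>\<^sub>3 \<theta>\<^sub>4 \<theta>\<^sub>5 by (auto simp: c_def b_def)
  have \<eta>: "\<eta> k = 2 / c / (real k + b)" for k
  proof -
    have "\<theta>\<^sub>3 * \<theta>\<^sub>4 * \<theta>\<^sub>5 * real k + 2 = c * \<theta>\<^sub>5 * (real k + b)"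
      using c \<theta>\<^sub>5 by (simp add: b_def c_def[symmetric] field_simps)
    then show ?thesis using \<theta>\<^sub>5 by (simp add: assms(19))
  qed
  have \<eta>_pos: "0 < \<eta> k" for k using b c by (simp add: \<eta> add_nonneg_pos)
  have \<eta>_Suc: "\<eta> (Suc k) \<le> \<eta> k" for k
    unfolding \<eta> using b c by (intro divide_left_mono) (auto intro!: mult_pos_pos add_nonneg_pos)
  have \<theta>\<^sub>2_le: "\<theta>\<^sub>2 \<le> C * \<beta>"
  proof -
    have "C * \<beta> / (2 * (1 + C)) \<le> C * \<beta> / 1" using C \<beta> by (intro divide_left_mono) auto
    then show ?thesis by (simp add: \<theta>\<^sub>2)
  qed
  \<comment> \<open>This makes the primal term contract at least at the common rate:
    \<open>\<theta>\<^sub>3\<close> is at most \<open>C * \<beta>\<close>, and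
    \<open>C * \<beta> * \<theta>\<^sub>4 < \<mu>\<close>.\<close>
  have c_\<mu>: "c \<le> \<mu>"
    using mult_right_mono[OF order_trans[OF \<theta>\<^sub>3(3) \<theta>\<^sub>2_le], of \<theta>\<^sub>4] \<theta>\<^sub>4 C\<beta>\<theta>
    unfolding c_def by linarith
  have \<eta>_lim: "\<eta> \<longlonglongrightarrow> 0"
  proof -
    have "(\<lambda>k. 2 / c / (b + real k)) \<longlonglongrightarrow> 0"
      by (intro tendsto_divide_0[OF tendsto_const] filterlim_at_top_imp_at_infinity
          filterlim_tendsto_add_at_top[OF tendsto_const filterlim_real_sequentially])
    then show ?thesis by (simp add: \<eta>[abs_def] add.commute)
  qed
  \<comment> \<open>Three conditions of \<open>lyapunov_step_expectation\<close> solved for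
    \<open>\<eta> k\<close>; the remaining \<open>p \<le> \<mu> * \<eta> k\<close> holds at every
    iteration by \<open>C\<beta>\<theta>\<close>.\<close>
  define \<delta> where "\<delta> = min (1 / (64 * (C * \<beta> * \<theta>\<^sub>4))) (min (2 / ((2 * C + 1) * (\<theta>\<^sub>4 * \<beta>))) (\<mu> / (16 * L\<^sup>2)))"
  have "0 < \<delta>" using C \<beta> \<theta>\<^sub>4 \<mu> L by (simp add: \<delta>_def)
  then have "\<forall>\<^sub>F k in sequentially. \<eta> k < \<delta>" by (rule order_tendstoD(2)[OF \<eta>_lim])
  then obtain k1 where k1: "\<And>k. k1 \<le> k \<Longrightarrow> \<eta> k < \<delta>" by (auto simp: eventually_sequentially)
  \<comment> \<open>The \<open>2\<close> guarantees \<open>1 \<le> k\<close>, where \<open>H\<close>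
    and \<open>D\<close> are specified, and \<open>3 / 2 \<le> k0 + b\<close>.\<close>
  define k0 where "k0 = max k1 2"
  define a where "a k = err_X k + 2 * \<eta> k / \<theta>\<^sub>4 * err_D k + 2 * (1 + C) * err_H k" for k
  define B where "B = 2 * (\<Sum>i\<in>UNIV. (\<sigma> i)\<^sup>2) * (2 / c)\<^sup>2"
  have "0 \<le> B" by (auto simp: B_def intro!: sum_nonneg mult_nonneg_nonneg)
  have step: "a (Suc k) \<le> (1 - 3 / 2 / (real k + b)) * a k + B / (real k + b)\<^sup>2" if "k0 \<le> k" for k
  proof -
    have k: "1 \<le> k" and "\<eta> k < \<delta>" using that k1[of k] by (auto simp: k0_def)
    then have small: "C * \<beta> * \<theta>\<^sub>4 * \<eta> k \<le> 1 / 64" "(2 * C + 1) * (\<theta>\<^sub>4 * \<beta>) * \<eta> k \<le> 2" "16 * L\<^sup>2 * \<eta> k \<le> \<mu>"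
      using C \<beta> \<theta>\<^sub>4 L by (auto simp: \<delta>_def pos_less_divide_eq mult_ac)
    have \<gamma>: "\<gamma> k = \<theta>\<^sub>4 * \<eta> k" by (rule assms(20))
    have w: "2 * (\<eta> k)\<^sup>2 / \<gamma> k = 2 * \<eta> k / \<theta>\<^sub>4"
      using \<eta>_pos[of k] by (simp add: \<gamma> power2_eq_square)
    have "C * \<beta> * \<theta>\<^sub>4 * \<eta> k \<le> \<mu> * \<eta> k"
      using C\<beta>\<theta> \<eta>_pos[of k] by (intro mult_right_mono) auto
    then have le: "err_X (Suc k) + 2 * \<eta> k / \<theta>\<^sub>4 * err_D (Suc k) + 2 * (1 + C) * err_H (Suc k)
      \<le> (1 - 3 / 4 * (\<mu> * \<eta> k)) * err_X k + 2 * \<eta> k / \<theta>\<^sub>4 * (1 - 3 * \<gamma> k / (8 * \<kappa>)) * err_D k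
        + 2 * (1 + C) * (1 - \<alpha> k) * err_H k + 2 * (\<Sum>i\<in>UNIV. (\<sigma> i)\<^sup>2) * (\<eta> k)\<^sup>2"
      using lyapunov_step_expectation[OF k \<eta>_pos] small C \<theta>\<^sub>4 \<eta>_pos[of k] assms(21)[of k]
      unfolding w \<kappa>_def A_def assms(12)[symmetric] by (simp add: \<gamma> mult_ac)
    \<comment> \<open>A common factor for all three errors. In units of
      \<open>\<theta>\<^sub>4 * \<eta> k\<close> the dual term contracts at rate
      \<open>3 / 4 * \<theta>\<^sub>1\<close> and the \<open>H\<close> term at rate
      \<open>\<theta>\<^sub>2\<close>; both dominate
      \<open>3 / 4 * \<theta>\<^sub>3\<close>.\<close>
    define \<rho> where "\<rho> = 1 - 3 / 4 * (c * \<eta> k)"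
    have r1: "1 - 3 / 4 * (\<mu> * \<eta> k) \<le> \<rho>"
      using mult_right_mono[OF c_\<mu>, of "\<eta> k"] \<eta>_pos[of k] by (simp add: \<rho>_def)
    have "c * \<eta> k \<le> \<theta>\<^sub>1 * (\<theta>\<^sub>4 * \<eta> k)" "c * \<eta> k \<le> \<theta>\<^sub>2 * (\<theta>\<^sub>4 * \<eta> k)"
      using \<theta>\<^sub>3 \<theta>\<^sub>4 \<eta>_pos[of k] by (auto simp: c_def mult.assoc intro!: mult_right_mono)
    moreover have "3 * \<gamma> k / (8 * \<kappa>) = 3 / 4 * (\<theta>\<^sub>1 * (\<theta>\<^sub>4 * \<eta> k))" "\<alpha> k = \<theta>\<^sub>2 * (\<theta>\<^sub>4 * \<eta> k)"
      by (simp_all add: \<theta>\<^sub>1 \<gamma> assms(21) \<theta>\<^sub>2)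
    ultimately have r2: "1 - 3 * \<gamma> k / (8 * \<kappa>) \<le> \<rho>" and r3: "1 - \<alpha> k \<le> \<rho>"
      using mult_pos_pos[OF c \<eta>_pos[of k]] by (auto simp: \<rho>_def)
    \<comment> \<open>\<open>a (Suc k)\<close> carries the dual weight of the next step size, which
      is no larger than the current one because \<eta> is nonincreasing.\<close>
    have "a (Suc k) \<le> err_X (Suc k) + 2 * \<eta> k / \<theta>\<^sub>4 * err_D (Suc k) + 2 * (1 + C) * err_H (Suc k)"
      unfolding a_def using \<theta>\<^sub>4 \<eta>_Suc
      by (intro add_mono mult_right_mono err_nonneg divide_right_mono mult_left_mono order_refl) auto
    also note le
    also have "(1 - 3 / 4 * (\<mu> * \<eta> k)) * err_X k + 2 * \<eta> k / \<theta>\<^sub>4 * (1 - 3 * \<gamma> k / (8 * \<kappa>)) * err_D k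
        + 2 * (1 + C) * (1 - \<alpha> k) * err_H k + 2 * (\<Sum>i\<in>UNIV. (\<sigma> i)\<^sup>2) * (\<eta> k)\<^sup>2
      \<le> \<rho> * err_X k + 2 * \<eta> k / \<theta>\<^sub>4 * \<rho> * err_D k + 2 * (1 + C) * \<rho> * err_H k
        + 2 * (\<Sum>i\<in>UNIV. (\<sigma> i)\<^sup>2) * (\<eta> k)\<^sup>2"
      using \<theta>\<^sub>4 C \<eta>_pos[of k]
      by (intro add_mono mult_right_mono mult_left_mono r1 r2 r3 err_nonneg order_refl) auto
    also have "\<dots> = \<rho> * a k + 2 * (\<Sum>i\<in>UNIV. (\<sigma> i)\<^sup>2) * (\<eta> k)\<^sup>2"
      by (simp add: a_def algebra_simps)
    also have "\<rho> = 1 - 3 / 2 / (real k + b)"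
      using c by (simp add: \<rho>_def \<eta>)
    also have "2 * (\<Sum>i\<in>UNIV. (\<sigma> i)\<^sup>2) * (\<eta> k)\<^sup>2 = B / (real k + b)\<^sup>2"
      by (simp add: B_def \<eta> power_divide power_mult_distrib)
    finally show ?thesis .
  qed
  have "3 / 2 \<le> real k0 + b" using b by (simp add: k0_def)
  from chung_recursion[OF b \<open>0 \<le> B\<close> this step] obtain K where
    K: "0 \<le> K" "\<And>k. k0 \<le> k \<Longrightarrow> a k \<le> K / (real k + b)" by blast
  have int: "integrable M (\<lambda>\<omega>. (norm (X k \<omega> $ i - xstar))\<^sup>2)" for k i
    using square_integrable_diff[OF square_integrable_component[OF state_square_integrable(1)] square_integrable_const]
    by (simp add: square_integrable_def)
  have err: "err k = err_X k / real CARD('n)" for k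
    using int unfolding assms(23) err_X_def norm_vec_square[of "_ :: real^'d^'n"]
    by (simp add: Xstar_def Bochner_Integration.integral_sum)
  have err_nn: "0 \<le> err k" for k by (simp add: err err_nonneg)
  have err_le: "err k \<le> K / real k" if "k0 \<le> k" for k
  proof -
    have "0 < k" using that by (simp add: k0_def)
    have "err k \<le> err_X k / 1"
      unfolding err using err_nonneg(1) by (intro divide_left_mono) (auto simp: Suc_leI)
    also have "\<dots> \<le> a k"
      unfolding a_def using \<theta>\<^sub>4 C \<eta>_pos[of k] err_nonneg by simp
    also have "\<dots> \<le> K / (real k + b)" by (rule K(2)[OF that])
    also have "\<dots> \<le> K / real k" using b K(1) \<open>0 < k\<close> by (intro divide_left_mono) auto
    finally show ?thesis .
  qed
  have "err \<in> O(\<lambda>k. 1 / real k)"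
  proof (rule bigoI)
    show "\<forall>\<^sub>F k in sequentially. norm (err k) \<le> K * norm (1 / real k)"
      unfolding eventually_sequentially using err_le err_nn by (intro exI[of _ k0]) auto
  qed
  moreover have "0 < k0" by (simp add: k0_def)
  ultimately show ?thesis
    using int inverse_rate_complexity[OF K(1) _ err_le] by blast
qed

end
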